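(* Let $\{X_t\}_{t\ge 0}$ be the stationary Ornstein-Uhlenbeck process with parameters $\alpha,\tau>0$, let $h:\mathbb{R}\to\mathbb{R}$ be strictly increasing and continuous, let $Y_t:=h(X_t)$, $t\ge 0$, and let $F(y):=\mathbb{P}(Y_t\le y)$ be the (stationary) distribution function of $Y_t$. Put $\sigma^2:=\tau^2/(2\alpha)$ and $\sigma_u^2:=\frac{\tau^2}{2\alpha}(1-e^{-2\alpha u})$ for $u>0$. Conditions $[A_+]$ (with constant $b_+$) and $[A_-]$ (with constant $b_-$) on $h$ are those defined in the context. Then the following assertions hold. (i) Under condition $[A_+]$, $1-F(y)=y^{-\beta_+}L_+(y)$, where $L_+$ is a function slowly varying as $y\to\infty$ and $\beta_+=1/(2b_+\sigma^2)=\alpha/(b_+\tau^2)$. (ii) Under condition $[A_-]$, $F(-y)=y^{-\beta_-}L_-(y)$, where $L_-$ is a function slowly varying as $y\to\infty$ and $\beta_-=1/(2b_-\sigma^2)=\alpha/(b_-\tau^2)$. (iii) Let $0\le s<t$ and let $F_{s,t}(y_s,y_t):=\mathbb{P}(Y_t\le y_t\mid Y_s=y_s)$ be the transition distribution function. Under condition $[A_+]$, for every $y_s$ in the range of $h$, the right tail $y\mapsto 1-F_{s,t}(y_s,y)$ is regularly varying as $y\to\infty$ of index $$-\beta_{+,t-s}:=-\frac{1}{2b_+\sigma_{t-s}^2}=-\frac{\alpha}{b_+\tau^2(1-e^{-2\alpha(t-s)})}<-\beta_+ ,\qquad \text{where } \beta_+=\frac{\alpha}{b_+\tau^2}.$$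 Under condition $[A_-]$, for every $y_s$ in the range of $h$, the left tail $y\mapsto F_{s,t}(y_s,-y)$ is regularly varying as $y\to\infty$ of index $-\beta_{-,t-s}:=-(2b_-\sigma_{t-s}^2)^{-1}$. (iv) If $[A_+]$ holds and $h(-x)=o(h(x))$ as $x\to\infty$, then, for any $0\le s<t$, the right tail of the distribution of the increment $Y_t-Y_s$ of the stationary process has the same regularly varying asymptotic behaviour at infinity as the right tail of $F$, i.e. $\mathbb{P}(Y_t-Y_s>y)\sim 1-F(y)$ as $y\to\infty$. Similarly, if $[A_-]$ holds and $h(x)=o(h(-x))$ as $x\to\infty$, then, for any $0\le s<t$, the right tail of the distribution of the increment $Y_t-Y_s$ of the stationary process has the same regularly varying asymptotic behaviour at infinity as the left tail of $F$, i.e. $\mathbb{P}(Y_t-Y_s>y)\sim F(-y)$ as $y\to\infty$.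
   Context: The stationary Ornstein-Uhlenbeck process with parameters $\alpha,\tau>0$ is the stationary solution of $dX_t=-\alpha X_t\,dt+\tau\,dW_t$, $t\ge 0$, where $W_t$ is a standard Wiener process. It is a Gaussian Markov process with $X_t\sim N(0,\sigma^2)$, $\sigma^2=\tau^2/(2\alpha)$, correlation function $\rho(X_s,X_t)=e^{-\alpha|t-s|}$, and, for $0\le s\le t$, the conditional distribution of $X_t$ given $X_s=x$ is normal with mean $xe^{-\alpha(t-s)}$ and variance $\sigma_{t-s}^2$, where $\sigma_u^2=\frac{\tau^2}{2\alpha}(1-e^{-2\alpha u})$. Since $h$ is strictly increasing, conditioning on $Y_s=y_s$ means conditioning on $X_s=h^{-1}(y_s)$. Condition $[A_+]$: for some constant $b_+>0$ and some differentiable function $f_+$, one has $h(x)=\exp\{b_+x^2+f_+(x)+o(1)\}$ with $f_+'(x)=o(x)$ as $x\to+\infty$. Condition $[A_-]$: for some constant $b_->0$ and some differentiable function $f_-$, one has $h(x)=-\exp\{b_-x^2+f_-(x)+o(1)\}$ with $f_-'(x)=o(x)$ as $x\to-\infty$. A positive (for all large arguments) measurable function $L$ is slowly varying as $y\to\infty$ if $L(\lambda y)/L(y)\to 1$ as $y\to\infty$ for every $\lambda>0$; a function of the form $y^{\gamma}L(y)$ with $L$ slowly varying is regularly varying of index $\gamma$. The notation $a(y)\sim b(y)$ means $a(y)/b(y)\to1$. *)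

theory Defs
  imports "HOL-Probability.Probability" "HOL-Library.Landau_Symbols"
begin

text \<open>All processes are indexed by the nonnegative reals; their values at negative times are
  irrelevant.\<close>

definition wiener_process :: "'a measure \<Rightarrow> (real \<Rightarrow> 'a \<Rightarrow> real) \<Rightarrow> bool" where
  "wiener_process M W \<longleftrightarrow>
     prob_space M \<and>
     (\<forall>t\<ge>0. W t \<in> borel_measurable M) \<and>
     (AE \<omega> in M. W 0 \<omega> = 0) \<and>
     (\<forall>n (t :: nat \<Rightarrow> real). 0 \<le> t 0 \<and> strict_mono t \<longrightarrow>
        prob_space.indep_vars M (\<lambda>_. borel) (\<lambda>i \<omega>. W (t (Suc i)) \<omega> - W (t i) \<omega>) {..<n}) \<and>
     (\<forall>s t. 0 \<le> s \<and> s < t \<longrightarrow>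
        distributed M lborel (\<lambda>\<omega>. W t \<omega> - W s \<omega>) (normal_density 0 (sqrt (t - s)))) \<and>
     (AE \<omega> in M. continuous_on {0..} (\<lambda>t. W t \<omega>))"

definition stationary_process :: "'a measure \<Rightarrow> (real \<Rightarrow> 'a \<Rightarrow> real) \<Rightarrow> bool" where
  "stationary_process M X \<longleftrightarrow>
     (\<forall>t\<ge>0. X t \<in> borel_measurable M) \<and>
     (\<forall>I u. finite I \<and> I \<subseteq> {0..} \<and> 0 \<le> u \<longrightarrow>
        distr M (\<Pi>\<^sub>M t\<in>I. borel) (\<lambda>\<omega>. \<lambda>t\<in>I. X (t + u) \<omega>) =
        distr M (\<Pi>\<^sub>M t\<in>I. borel) (\<lambda>\<omega>. \<lambda>t\<in>I. X t \<omega>))"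

text \<open>The noise in \<open>dX = - \<alpha> X dt + \<tau> dW\<close> is additive, so the equation in its integrated
  form involves no stochastic integral and is read path by path. As usual, the initial value is
  independent of the driving Wiener process. The distribution of \<open>X 0\<close> is not prescribed: it is
  determined by stationarity.\<close>

definition stationary_OU ::
    "'a measure \<Rightarrow> real \<Rightarrow> real \<Rightarrow> (real \<Rightarrow> 'a \<Rightarrow> real) \<Rightarrow> bool" where
  "stationary_OU M \<alpha> \<tau> X \<longleftrightarrow>
     prob_space M \<and> stationary_process M X \<and>
     (\<exists>W. wiener_process M W \<and>
        prob_space.indep_set M
          (sets (vimage_algebra (space M) (X 0) borel))
          (sets (vimage_algebra (space M) (\<lambda>\<omega>. \<lambda>t\<in>{0..}. W t \<omega>) (\<Pi>\<^sub>M t\<in>{0..}. borel))) \<and>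
        (AE \<omega> in M. continuous_on {0..} (\<lambda>t. X t \<omega>) \<and>
           (\<forall>t\<ge>0. X t \<omega> = X 0 \<omega> - \<alpha> * integral {0..t} (\<lambda>s. X s \<omega>) + \<tau> * W t \<omega>)))"

definition cond_A_plus :: "(real \<Rightarrow> real) \<Rightarrow> real \<Rightarrow> bool" where
  "cond_A_plus h b \<longleftrightarrow> 0 < b \<and>
     (\<exists>f r. (\<forall>x. f differentiable (at x)) \<and> deriv f \<in> o[at_top](\<lambda>x. x) \<and>
        (r \<longlongrightarrow> 0) at_top \<and>
        (\<forall>\<^sub>F x in at_top. h x = exp (b * x\<^sup>2 + f x + r x)))"

definition cond_A_minus :: "(real \<Rightarrow> real) \<Rightarrow> real \<Rightarrow> bool" where
  "cond_A_minus h b \<longleftrightarrow> 0 < b \<and>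
     (\<exists>f r. (\<forall>x. f differentiable (at x)) \<and> deriv f \<in> o[at_bot](\<lambda>x. x) \<and>
        (r \<longlongrightarrow> 0) at_bot \<and>
        (\<forall>\<^sub>F x in at_bot. h x = - exp (b * x\<^sup>2 + f x + r x)))"

definition slowly_varying :: "(real \<Rightarrow> real) \<Rightarrow> bool" where
  "slowly_varying L \<longleftrightarrow> L \<in> borel_measurable borel \<and> (\<forall>\<^sub>F y in at_top. 0 < L y) \<and>
     (\<forall>c>0. ((\<lambda>y. L (c * y) / L y) \<longlongrightarrow> 1) at_top)"

definition regularly_varying :: "real \<Rightarrow> (real \<Rightarrow> real) \<Rightarrow> bool" where
  "regularly_varying \<gamma> g \<longleftrightarrow> (\<exists>L. slowly_varying L \<and> (\<forall>y>0. g y = y powr \<gamma> * L y))"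

text \<open>\<open>cond_distribution M Z V R K\<close>: the kernel \<open>K\<close> is a regular conditional distribution of \<open>V\<close>
  given \<open>Z\<close> which is weakly continuous on \<open>R\<close>. A regular conditional distribution is unique only
  up to null sets of the law of \<open>Z\<close>; if \<open>R\<close> is contained in the support of that law, continuity
  determines \<open>K z\<close> for every single \<open>z \<in> R\<close>, so that conditioning on the null event \<open>Z = z\<close>
  has a meaning. The values of \<open>K\<close> outside \<open>R\<close> are irrelevant when \<open>Z\<close> takes its values in
  \<open>R\<close>.\<close>

definition cond_distribution ::
    "'a measure \<Rightarrow> ('a \<Rightarrow> real) \<Rightarrow> ('a \<Rightarrow> real) \<Rightarrow> real set \<Rightarrow> (real \<Rightarrow> real measure) \<Rightarrow> bool" where
  "cond_distribution M Z V R K \<longleftrightarrow>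
     K \<in> borel \<rightarrow>\<^sub>M prob_algebra borel \<and>
     (\<forall>A\<in>sets borel. \<forall>B\<in>sets borel.
        measure M {\<omega> \<in> space M. Z \<omega> \<in> A \<and> V \<omega> \<in> B} =
        (\<integral>\<omega>. indicator A (Z \<omega>) * measure (K (Z \<omega>)) B \<partial>M)) \<and>
     (\<forall>z zs. z \<in> R \<and> (\<forall>n. zs n \<in> R) \<and> zs \<longlonglongrightarrow> z \<longrightarrow> weak_conv_m (\<lambda>n. K (zs n)) (K z))"

end

theory Submission
  imports Defs "HOL-Real_Asymp.Real_Asymp"
begin

text \<open>Let \<open>x = h\<^sup>-\<^sup>1(y)\<close> and \<open>x' = h\<^sup>-\<^sup>1(c y)\<close>. Since \<open>f' = o(x)\<close>, the increment \<open>f(x') - f(x)\<close> is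
  negligible compared to \<open>x'\<^sup>2 - x\<^sup>2\<close>, so \<open>[A\<^sub>+]\<close> forces \<open>x'\<^sup>2 - x\<^sup>2 \<rightarrow> ln c / b\<close>. By the Mills ratio, the
  tail of \<open>h(N(\<mu>, \<sigma>\<^sup>2))\<close> is then regularly varying of index \<open>- 1 / (2 b \<sigma>\<^sup>2)\<close>, whatever \<open>\<mu>\<close>; this
  covers both the stationary law and the transition laws, and reflection \<open>x \<mapsto> - h(- x)\<close> covers the
  left tails.

  The Gaussian laws are obtained without solving the equation: \<open>e\<^sup>\<alpha>\<^sup>T X\<^sub>T - X\<^sub>0\<close> is the pathwise limit of
  the sums \<open>\<Sum> \<tau> e\<^sup>\<alpha>\<^sup>u (W\<^sub>v - W\<^sub>u)\<close> over partitions of \<open>[0, T]\<close>, hence Gaussian and independent of \<open>X\<^sub>0\<close>,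
  and stationarity with \<open>T \<rightarrow> \<infinity>\<close> identifies the law of \<open>X\<^sub>0\<close> through its characteristic function.

  In an increment \<open>h(U) - h(V)\<close>, the contribution of \<open>- h(V)\<close> is negligible because
  \<open>h(- x) = o(h(x))\<close>, and \<open>h(U)\<close>, \<open>h(V)\<close> are not both large, because \<open>U\<close> and \<open>V\<close> are not perfectly
  correlated.\<close>

section \<open>Gaussian tails\<close>

text \<open>Assertion (iii) conditions on \<open>Y s = ys\<close>, a null event, and is claimed for
  every weakly continuous kernel, so the Gaussian transition law alone does not settle it. One
  kernel is built explicitly by pushing the law of the innovation through \<open>h\<close>. Any
  other one agrees with it on a set of full measure for the law of \<open>Y s\<close>. Since a
  normal law charges every interval, such a set accumulates at every point of
  \<open>range h\<close>, and weak continuity turns almost sure agreement into agreement at each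
  point.

  A second obstacle is that only \<open>X 0\<close> is assumed independent of the driving Wiener
  process. The innovation is therefore constructed from time 0 alone, and the independence of
  \<open>X s\<close> and the innovation after s is recovered from the joint law of two coordinates,
  which stationarity moves back to time 0.

  In (iv) two limits are taken in a fixed order: an auxiliary fraction e of the level is kept fixed
  while y grows, and only afterwards tends to 0.\<close>

abbreviation normal_law :: "real \<Rightarrow> real \<Rightarrow> real measure" where
  "normal_law \<mu> \<sigma> \<equiv> density lborel (\<lambda>x. ennreal (normal_density \<mu> \<sigma> x))"

lemma real_distribution_normal_law: "0 < \<sigma> \<Longrightarrow> real_distribution (normal_law \<mu> \<sigma>)"
  using prob_space_normal_density[of \<sigma> \<mu>]
  by (auto simp: real_distribution_def real_distribution_axioms_def)

lemma DERIV_normal_density: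
  assumes "0 < \<sigma>"
  shows "DERIV (normal_density \<mu> \<sigma>) x :> - (x - \<mu>) / \<sigma>\<^sup>2 * normal_density \<mu> \<sigma> x"
proof -
  have "DERIV (\<lambda>x. - (x - \<mu>)\<^sup>2 / (2 * \<sigma>\<^sup>2)) x :> - (2 * (x - \<mu>)) / (2 * \<sigma>\<^sup>2)"
    by (rule DERIV_cdivide) (auto intro!: derivative_eq_intros)
  from DERIV_cmult[OF DERIV_fun_exp[OF this], of "1 / sqrt (2 * pi * \<sigma>\<^sup>2)"]
  have "DERIV (normal_density \<mu> \<sigma>) x :>
      1 / sqrt (2 * pi * \<sigma>\<^sup>2) * (exp (- (x - \<mu>)\<^sup>2 / (2 * \<sigma>\<^sup>2)) * (- (2 * (x - \<mu>)) / (2 * \<sigma>\<^sup>2)))"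
    unfolding normal_density_def[abs_def] .
  moreover have "- (2 * (x - \<mu>)) / (2 * \<sigma>\<^sup>2) = - (x - \<mu>) / \<sigma>\<^sup>2"
    by (metis mult_divide_mult_cancel_left_if mult_minus_right zero_neq_numeral)
  ultimately show ?thesis
    unfolding normal_density_def by (simp only: mult_ac)
qed

text \<open>The function \<open>\<sigma>\<^sup>2 \<phi>(x) / (x - \<mu>)\<close> has derivative \<open>- \<phi>(x) (1 + \<sigma>\<^sup>2 / (x - \<mu>)\<^sup>2)\<close>.\<close>

lemma normal_mills_integral:
  assumes "0 < \<sigma>" "\<mu> < x"
  shows "(\<integral>\<^sup>+t. ennreal (normal_density \<mu> \<sigma> t * (1 + \<sigma>\<^sup>2 / (t - \<mu>)\<^sup>2)) * indicator {x..} t \<partial>lborel)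
    = ennreal (\<sigma>\<^sup>2 * normal_density \<mu> \<sigma> x / (x - \<mu>))"
proof -
  let ?G = "\<lambda>t. - (\<sigma>\<^sup>2 * normal_density \<mu> \<sigma> t / (t - \<mu>))"
  have "((\<lambda>t. - (\<sigma>\<^sup>2 * (1 / sqrt (2 * pi * \<sigma>\<^sup>2) * exp (- (t - \<mu>)\<^sup>2 / (2 * \<sigma>\<^sup>2))) / (t - \<mu>))) \<longlongrightarrow> 0) at_top"
    using assms by real_asymp
  then have lim: "(?G \<longlongrightarrow> 0) at_top"
    by (simp add: normal_density_def)
  have "(\<integral>\<^sup>+t. ennreal (normal_density \<mu> \<sigma> t * (1 + \<sigma>\<^sup>2 / (t - \<mu>)\<^sup>2)) * indicator {x..} t \<partial>lborel) = 0 - ?G x"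
  proof (rule nn_integral_FTC_atLeast[OF _ _ _ lim])
    fix t assume t: "x \<le> t"
    then have "t - \<mu> \<noteq> 0" using assms by auto
    define z \<phi> where "z = t - \<mu>" and "\<phi> = normal_density \<mu> \<sigma> t"
    have z: "z \<noteq> 0" using \<open>t - \<mu> \<noteq> 0\<close> by (simp add: z_def)
    have "DERIV (\<lambda>t. \<sigma>\<^sup>2 * normal_density \<mu> \<sigma> t / (t - \<mu>)) t :>
      (\<sigma>\<^sup>2 * (- (t - \<mu>) / \<sigma>\<^sup>2 * normal_density \<mu> \<sigma> t) * (t - \<mu>) - \<sigma>\<^sup>2 * normal_density \<mu> \<sigma> t * (1 - 0))
        / ((t - \<mu>) * (t - \<mu>))"
      by (intro DERIV_divide DERIV_cmult DERIV_diff DERIV_ident DERIV_const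
          DERIV_normal_density assms \<open>t - \<mu> \<noteq> 0\<close>)
    from DERIV_minus[OF this] have "DERIV ?G t :>
      - ((\<sigma>\<^sup>2 * (- z / \<sigma>\<^sup>2 * \<phi>) * z - \<sigma>\<^sup>2 * \<phi> * (1 - 0)) / (z * z))"
      by (simp only: z_def \<phi>_def)
    also have "\<sigma>\<^sup>2 * (- z / \<sigma>\<^sup>2 * \<phi>) * z = - (z * z * \<phi>)"
      using assms by simp
    also have "- ((- (z * z * \<phi>) - \<sigma>\<^sup>2 * \<phi> * (1 - 0)) / (z * z)) = \<phi> * (1 + \<sigma>\<^sup>2 / z\<^sup>2)"
      using z by (simp add: power2_eq_square divide_simps) (simp add: algebra_simps)
    finally show "DERIV ?G t :> normal_density \<mu> \<sigma> t * (1 + \<sigma>\<^sup>2 / (t - \<mu>)\<^sup>2)"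
      by (simp only: z_def \<phi>_def)
  qed (auto intro!: mult_nonneg_nonneg normal_density_nonneg)
  then show ?thesis by simp
qed

definition normal_tail :: "real \<Rightarrow> real \<Rightarrow> real \<Rightarrow> real" where
  "normal_tail \<mu> \<sigma> x = measure (normal_law \<mu> \<sigma>) {x<..}"

text \<open>\<open>normal_mills_integral\<close> integrates over a closed half-line, the form that
  \<open>nn_integral_FTC_atLeast\<close> supplies. The endpoint is a null set, so the open tail can
  be compared with it under the integral.\<close>

lemma emeasure_normal_law_Ioi:
  assumes "0 < \<sigma>"
  shows "ennreal (normal_tail \<mu> \<sigma> x) = (\<integral>\<^sup>+t. ennreal (normal_density \<mu> \<sigma> t) * indicator {x..} t \<partial>lborel)"
proof -
  interpret real_distribution "normal_law \<mu> \<sigma>" by (rule real_distribution_normal_law[OF assms])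
  have "ennreal (normal_tail \<mu> \<sigma> x) = emeasure (normal_law \<mu> \<sigma>) {x<..}"
    by (simp add: normal_tail_def emeasure_eq_measure)
  also have "\<dots> = (\<integral>\<^sup>+t. ennreal (normal_density \<mu> \<sigma> t) * indicator {x<..} t \<partial>lborel)"
    by (simp add: emeasure_density)
  also have "\<dots> = (\<integral>\<^sup>+t. ennreal (normal_density \<mu> \<sigma> t) * indicator {x..} t \<partial>lborel)"
    using AE_lborel_singleton[of x] by (intro nn_integral_cong_AE) (auto simp: indicator_def)
  finally show ?thesis .
qed

text \<open>For \<open>t \<ge> x\<close> the Mills integrand lies between the density and
  \<open>1 + \<sigma>\<^sup>2 / (x - \<mu>)\<^sup>2\<close> times the density, because the
  correction term decreases in t. Integrating over the half-line gives both bounds.\<close>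

lemma normal_tail_mills:
  assumes "0 < \<sigma>" "\<mu> < x"
  shows "normal_tail \<mu> \<sigma> x \<le> \<sigma>\<^sup>2 * normal_density \<mu> \<sigma> x / (x - \<mu>)"
    and "\<sigma>\<^sup>2 * normal_density \<mu> \<sigma> x / (x - \<mu>) \<le> (1 + \<sigma>\<^sup>2 / (x - \<mu>)\<^sup>2) * normal_tail \<mu> \<sigma> x"
proof -
  have nn: "0 \<le> \<sigma>\<^sup>2 * normal_density \<mu> \<sigma> x / (x - \<mu>)"
    using assms by (auto intro!: mult_nonneg_nonneg divide_nonneg_nonneg)
  have "ennreal (normal_tail \<mu> \<sigma> x) \<le> ennreal (\<sigma>\<^sup>2 * normal_density \<mu> \<sigma> x / (x - \<mu>))"
    unfolding emeasure_normal_law_Ioi[OF assms(1)] normal_mills_integral[OF assms, symmetric]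
    by (intro nn_integral_mono)
       (auto simp: indicator_def intro!: ennreal_leI mult_right_le_one_le simp: algebra_simps)
  then show "normal_tail \<mu> \<sigma> x \<le> \<sigma>\<^sup>2 * normal_density \<mu> \<sigma> x / (x - \<mu>)"
    using nn by (simp add: ennreal_le_iff)
  have "ennreal (\<sigma>\<^sup>2 * normal_density \<mu> \<sigma> x / (x - \<mu>)) \<le>
    (\<integral>\<^sup>+t. ennreal (1 + \<sigma>\<^sup>2 / (x - \<mu>)\<^sup>2) * (ennreal (normal_density \<mu> \<sigma> t) * indicator {x..} t) \<partial>lborel)"
    unfolding normal_mills_integral[OF assms, symmetric]
  proof (intro nn_integral_mono)
    fix t
    show "ennreal (normal_density \<mu> \<sigma> t * (1 + \<sigma>\<^sup>2 / (t - \<mu>)\<^sup>2)) * indicator {x..} t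
      \<le> ennreal (1 + \<sigma>\<^sup>2 / (x - \<mu>)\<^sup>2) * (ennreal (normal_density \<mu> \<sigma> t) * indicator {x..} t)"
    proof (cases "x \<le> t")
      case True
      then have "1 + \<sigma>\<^sup>2 / (t - \<mu>)\<^sup>2 \<le> 1 + \<sigma>\<^sup>2 / (x - \<mu>)\<^sup>2"
        using assms by (intro add_left_mono divide_left_mono power_mono mult_pos_pos zero_less_power) auto
      then have "normal_density \<mu> \<sigma> t * (1 + \<sigma>\<^sup>2 / (t - \<mu>)\<^sup>2) \<le> (1 + \<sigma>\<^sup>2 / (x - \<mu>)\<^sup>2) * normal_density \<mu> \<sigma> t"
        by (subst mult.commute, intro mult_right_mono) auto
      also have "ennreal \<dots> = ennreal (1 + \<sigma>\<^sup>2 / (x - \<mu>)\<^sup>2) * ennreal (normal_density \<mu> \<sigma> t)"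
        by (intro ennreal_mult add_nonneg_nonneg) auto
      finally (ord_le_eq_trans[OF ennreal_leI]) show ?thesis using True by simp
    qed simp
  qed
  also have "\<dots> = ennreal (1 + \<sigma>\<^sup>2 / (x - \<mu>)\<^sup>2) * ennreal (normal_tail \<mu> \<sigma> x)"
    by (simp add: nn_integral_cmult emeasure_normal_law_Ioi[OF assms(1)])
  also have "\<dots> = ennreal ((1 + \<sigma>\<^sup>2 / (x - \<mu>)\<^sup>2) * normal_tail \<mu> \<sigma> x)"
    by (simp add: ennreal_mult normal_tail_def)
  finally show "\<sigma>\<^sup>2 * normal_density \<mu> \<sigma> x / (x - \<mu>) \<le> (1 + \<sigma>\<^sup>2 / (x - \<mu>)\<^sup>2) * normal_tail \<mu> \<sigma> x"
    using nn by (subst (asm) ennreal_le_iff) (auto simp: normal_tail_def)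
qed

lemma normal_tail_pos:
  assumes "0 < \<sigma>" "\<mu> < x"
  shows "0 < normal_tail \<mu> \<sigma> x"
proof -
  have "0 < \<sigma>\<^sup>2 * normal_density \<mu> \<sigma> x / (x - \<mu>)"
    using assms normal_density_pos[of \<sigma> \<mu> x] by auto
  then have "0 < (1 + \<sigma>\<^sup>2 / (x - \<mu>)\<^sup>2) * normal_tail \<mu> \<sigma> x"
    using normal_tail_mills(2)[OF assms] by linarith
  moreover have "0 \<le> normal_tail \<mu> \<sigma> x" by (simp add: normal_tail_def)
  ultimately show ?thesis by (cases "normal_tail \<mu> \<sigma> x = 0") auto
qed

text \<open>Both Mills bounds control the quotient of the approximation by the tail, catching it
  between 1 and a quantity that tends to 1. The equivalence is therefore proved in the flipped
  direction.\<close>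

lemma normal_tail_asymp_equiv:
  assumes "0 < \<sigma>"
  shows "normal_tail \<mu> \<sigma> \<sim>[at_top] (\<lambda>x. \<sigma>\<^sup>2 * normal_density \<mu> \<sigma> x / (x - \<mu>))"
proof (rule asymp_equiv_symI, rule asymp_equivI'_const[where c = 1, simplified])
  show "((\<lambda>x. \<sigma>\<^sup>2 * normal_density \<mu> \<sigma> x / (x - \<mu>) / normal_tail \<mu> \<sigma> x) \<longlongrightarrow> 1) at_top"
  proof (rule tendsto_sandwich)
    have ev: "eventually (\<lambda>x. \<mu> < x) at_top" by (rule eventually_gt_at_top)
    show "\<forall>\<^sub>F x in at_top. 1 \<le> \<sigma>\<^sup>2 * normal_density \<mu> \<sigma> x / (x - \<mu>) / normal_tail \<mu> \<sigma> x"
      using ev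
    proof eventually_elim
      case (elim x)
      show ?case
        using normal_tail_mills(1)[OF assms elim] normal_tail_pos[OF assms elim]
        by (subst le_divide_eq_1_pos)
    qed
    show "\<forall>\<^sub>F x in at_top. \<sigma>\<^sup>2 * normal_density \<mu> \<sigma> x / (x - \<mu>) / normal_tail \<mu> \<sigma> x \<le> 1 + \<sigma>\<^sup>2 / (x - \<mu>)\<^sup>2"
      using ev
    proof eventually_elim
      case (elim x)
      show ?case
        using normal_tail_mills(2)[OF assms elim] normal_tail_pos[OF assms elim]
        by (subst pos_divide_le_eq)
    qed
    show "((\<lambda>x. 1 + \<sigma>\<^sup>2 / (x - \<mu>)\<^sup>2) \<longlongrightarrow> 1) at_top" by real_asymp
  qed simp
qed

text \<open>The two exponents differ by
  \<open>(p y)\<^sup>2 - (q y)\<^sup>2 - 2 * \<mu> * (p y - q y)\<close> up to the factor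
  \<open>- 1 / (2 * \<sigma>\<^sup>2)\<close>. As p + q tends to infinity while the difference of
  squares converges, p - q tends to 0. So the mean drops out of the limit and the denominators of
  the Mills approximations are asymptotically equal.\<close>

lemma normal_tail_ratio:
  assumes \<sigma>: "0 < \<sigma>" and p: "filterlim p at_top G" and q: "filterlim q at_top G"
    and d: "((\<lambda>y. (p y)\<^sup>2 - (q y)\<^sup>2) \<longlongrightarrow> k) G"
  shows "((\<lambda>y. normal_tail \<mu> \<sigma> (p y) / normal_tail \<mu> \<sigma> (q y)) \<longlongrightarrow> exp (- (k / (2 * \<sigma>\<^sup>2)))) G"
    and "((\<lambda>y. p y - q y) \<longlongrightarrow> 0) G"
proof -
  have evp: "eventually (\<lambda>y. p y > \<bar>\<mu>\<bar> + 1) G" and evq: "eventually (\<lambda>y. q y > \<bar>\<mu>\<bar> + 1) G"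
    using p q by (simp_all add: filterlim_at_top_dense)
  have "((\<lambda>y. ((p y)\<^sup>2 - (q y)\<^sup>2) / (p y + q y)) \<longlongrightarrow> 0) G"
    by (rule tendsto_divide_0[OF d]) (intro filterlim_at_top_imp_at_infinity filterlim_at_top_add_at_top p q)
  moreover have "\<forall>\<^sub>F y in G. ((p y)\<^sup>2 - (q y)\<^sup>2) / (p y + q y) = p y - q y"
    using evp evq by eventually_elim (simp add: power2_eq_square square_diff_square_factored)
  ultimately show diff: "((\<lambda>y. p y - q y) \<longlongrightarrow> 0) G"
    by (simp cong: filterlim_cong)
  have qm: "filterlim (\<lambda>y. q y - \<mu>) at_top G" and pm: "filterlim (\<lambda>y. p y - \<mu>) at_top G"
    using filterlim_tendsto_add_at_top[OF tendsto_const[of "-\<mu>"] q]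
      filterlim_tendsto_add_at_top[OF tendsto_const[of "-\<mu>"] p] by simp_all
  have "((\<lambda>y. 1 - (p y - q y) / (p y - \<mu>)) \<longlongrightarrow> 1 - 0) G"
    by (intro tendsto_diff tendsto_const tendsto_divide_0[OF diff] filterlim_at_top_imp_at_infinity pm)
  moreover have "\<forall>\<^sub>F y in G. 1 - (p y - q y) / (p y - \<mu>) = (q y - \<mu>) / (p y - \<mu>)"
    using evp by eventually_elim (auto simp: field_simps)
  ultimately have ratio: "((\<lambda>y. (q y - \<mu>) / (p y - \<mu>)) \<longlongrightarrow> 1) G"
    by (simp cong: filterlim_cong)
  have "((\<lambda>y. exp (- ((((p y)\<^sup>2 - (q y)\<^sup>2) - 2 * \<mu> * (p y - q y)) / (2 * \<sigma>\<^sup>2)))) \<longlongrightarrow> exp (- ((k - 2 * \<mu> * 0) / (2 * \<sigma>\<^sup>2)))) G"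
    using \<sigma> by (intro tendsto_intros d diff) auto
  from tendsto_mult[OF this ratio] have lim: "((\<lambda>y. exp (- ((((p y)\<^sup>2 - (q y)\<^sup>2) - 2 * \<mu> * (p y - q y)) / (2 * \<sigma>\<^sup>2)))
      * ((q y - \<mu>) / (p y - \<mu>))) \<longlongrightarrow> exp (- (k / (2 * \<sigma>\<^sup>2)))) G" by simp
  let ?m = "\<lambda>x. \<sigma>\<^sup>2 * normal_density \<mu> \<sigma> x / (x - \<mu>)"
  have "(\<lambda>y. normal_tail \<mu> \<sigma> (p y) / normal_tail \<mu> \<sigma> (q y)) \<sim>[G] (\<lambda>y. ?m (p y) / ?m (q y))"
    using asymp_equiv_compose'[OF normal_tail_asymp_equiv[OF \<sigma>] p]
      asymp_equiv_compose'[OF normal_tail_asymp_equiv[OF \<sigma>] q] by (rule asymp_equiv_intros)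
  moreover have "((\<lambda>y. ?m (p y) / ?m (q y)) \<longlongrightarrow> exp (- (k / (2 * \<sigma>\<^sup>2)))) G"
  proof (rule Lim_transform_eventually[OF lim])
    show "\<forall>\<^sub>F y in G. exp (- ((((p y)\<^sup>2 - (q y)\<^sup>2) - 2 * \<mu> * (p y - q y)) / (2 * \<sigma>\<^sup>2)))
      * ((q y - \<mu>) / (p y - \<mu>)) = ?m (p y) / ?m (q y)"
      using evp evq
    proof eventually_elim
      case (elim y)
      have "- ((((p y)\<^sup>2 - (q y)\<^sup>2) - 2 * \<mu> * (p y - q y)) / (2 * \<sigma>\<^sup>2)) =
        - (p y - \<mu>)\<^sup>2 / (2 * \<sigma>\<^sup>2) - (- (q y - \<mu>)\<^sup>2 / (2 * \<sigma>\<^sup>2))"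
        by (simp add: power2_eq_square algebra_simps diff_divide_distrib add_divide_distrib)
      then have "exp (- ((((p y)\<^sup>2 - (q y)\<^sup>2) - 2 * \<mu> * (p y - q y)) / (2 * \<sigma>\<^sup>2))) =
        normal_density \<mu> \<sigma> (p y) / normal_density \<mu> \<sigma> (q y)"
        using \<sigma> by (simp only: exp_diff) (simp add: normal_density_def)
      then show ?case using \<sigma> by simp
    qed
  qed
  ultimately show "((\<lambda>y. normal_tail \<mu> \<sigma> (p y) / normal_tail \<mu> \<sigma> (q y)) \<longlongrightarrow> exp (- (k / (2 * \<sigma>\<^sup>2)))) G"
    using asymp_equiv_sym tendsto_asymp_equiv_cong by blast
qed

text \<open>The numerator decays like
  \<open>exp (- (4 / (2 * w\<^sup>2)) * (x - 1)\<^sup>2)\<close>, the denominator like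
  \<open>exp (- (1 / (2 * \<sigma>\<^sup>2)) * x\<^sup>2)\<close>. The constant \<open>e\<close> is
  the gap between these two rates, positive exactly because \<open>w < 2 * \<sigma>\<close>; the
  term \<open>e * x\<^sup>2\<close> swallows the linear term caused by the shift by 1.\<close>

lemma normal_tail_ratio_0:
  assumes "0 < \<sigma>" "0 < w" "w < 2 * \<sigma>"
  shows "((\<lambda>x. normal_tail 0 w (2 * (x - 1)) / normal_tail 0 \<sigma> x) \<longlongrightarrow> 0) at_top"
proof -
  define q where "q = 1 / (2 * \<sigma>\<^sup>2)"
  define e where "e = 4 / (2 * w\<^sup>2) - q"
  have "w\<^sup>2 < (2 * \<sigma>)\<^sup>2" using assms by (intro power_strict_mono) auto
  then have e: "0 < e" and q: "0 < q"
    using assms by (auto simp: e_def q_def field_simps power2_eq_square)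
  have we: "- (2 * (x - 1))\<^sup>2 / (2 * w\<^sup>2) = - ((q + e) * (x - 1)\<^sup>2)" for x
    by (simp add: e_def power_mult_distrib del: right_diff_distrib_numeral)
  have xe: "- x\<^sup>2 / (2 * \<sigma>\<^sup>2) = - (q * x\<^sup>2)" for x
    by (simp add: q_def)
  let ?m = "\<lambda>\<sigma> x. \<sigma>\<^sup>2 * normal_density 0 \<sigma> x / (x - 0)"
  have "(\<lambda>x. normal_tail 0 w (2 * (x - 1)) / normal_tail 0 \<sigma> x) \<sim>[at_top] (\<lambda>x. ?m w (2 * (x - 1)) / ?m \<sigma> x)"
  proof (rule asymp_equiv_divide)
    have "filterlim (\<lambda>x::real. 2 * (x - 1)) at_top at_top" by real_asymp
    then show "(\<lambda>x. normal_tail 0 w (2 * (x - 1))) \<sim>[at_top] (\<lambda>x. ?m w (2 * (x - 1)))"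
      by (rule asymp_equiv_compose'[OF normal_tail_asymp_equiv[OF assms(2)]])
  qed (rule normal_tail_asymp_equiv[OF assms(1)])
  moreover have "((\<lambda>x. (w\<^sup>2 / sqrt (2 * pi * w\<^sup>2)) / (\<sigma>\<^sup>2 / sqrt (2 * pi * \<sigma>\<^sup>2)) *
      (exp (- (e * x\<^sup>2) + 2 * (q + e) * x - (q + e)) * (x / (2 * (x - 1))))) \<longlongrightarrow> 0) at_top"
  proof (intro tendsto_mult_right_zero)
    have "((\<lambda>x. exp (- (e * x\<^sup>2) + a * x - c)) \<longlongrightarrow> 0) at_top" for a c
      using e by real_asymp
    moreover have "((\<lambda>x::real. x / (2 * (x - 1))) \<longlongrightarrow> 1 / 2) at_top"
      by real_asymp
    ultimately show "((\<lambda>x. exp (- (e * x\<^sup>2) + 2 * (q + e) * x - (q + e)) * (x / (2 * (x - 1)))) \<longlongrightarrow> 0) at_top"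
      using tendsto_mult[of _ 0 at_top _ "1 / 2"] by fastforce
  qed
  then have "((\<lambda>x. (w\<^sup>2 / sqrt (2 * pi * w\<^sup>2)) / (\<sigma>\<^sup>2 / sqrt (2 * pi * \<sigma>\<^sup>2)) *
      ((exp (- ((q + e) * (x - 1)\<^sup>2)) / (2 * (x - 1))) / (exp (- (q * x\<^sup>2)) / x))) \<longlongrightarrow> 0) at_top"
  proof (rule Lim_transform_eventually, intro always_eventually allI)
    fix x :: real
    have "- (e * x\<^sup>2) + 2 * (q + e) * x - (q + e) = - ((q + e) * (x - 1)\<^sup>2) - (- (q * x\<^sup>2))"
      by (simp add: algebra_simps power2_eq_square)
    then show "(w\<^sup>2 / sqrt (2 * pi * w\<^sup>2)) / (\<sigma>\<^sup>2 / sqrt (2 * pi * \<sigma>\<^sup>2)) *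
      (exp (- (e * x\<^sup>2) + 2 * (q + e) * x - (q + e)) * (x / (2 * (x - 1)))) =
      (w\<^sup>2 / sqrt (2 * pi * w\<^sup>2)) / (\<sigma>\<^sup>2 / sqrt (2 * pi * \<sigma>\<^sup>2)) *
      ((exp (- ((q + e) * (x - 1)\<^sup>2)) / (2 * (x - 1))) / (exp (- (q * x\<^sup>2)) / x))"
      by (simp only: exp_diff) simp
  qed
  then have "((\<lambda>x. ?m w (2 * (x - 1)) / ?m \<sigma> x) \<longlongrightarrow> 0) at_top"
    by (simp only: normal_density_def diff_zero we xe) (simp add: mult_ac)
  ultimately show ?thesis
    using asymp_equiv_sym tendsto_asymp_equiv_cong by blast
qed

section \<open>Transformed Gaussian tails\<close>

text \<open>By the mean value theorem the increment is at most \<open>e * z * (y - x)\<close> for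
  some z between x and y. Enlarging z to x + y makes this a difference of squares, the scale on
  which \<open>f\<close> has to be compared with the quadratic term of the condition.\<close>

lemma deriv_small_diff_bound:
  fixes f :: "real \<Rightarrow> real"
  assumes f: "\<And>x. f differentiable (at x)" and o: "deriv f \<in> o[at_top](\<lambda>x. x)" and e: "0 < e"
  shows "\<exists>x0>0. \<forall>x\<ge>x0. \<forall>y\<ge>x0. \<bar>f x - f y\<bar> \<le> e * \<bar>x\<^sup>2 - y\<^sup>2\<bar>"
proof -
  from landau_o.smallD[OF o e] obtain x1 where x1: "\<And>x. x1 \<le> x \<Longrightarrow> \<bar>deriv f x\<bar> \<le> e * \<bar>x\<bar>"
    by (auto simp: eventually_at_top_linorder)
  have *: "\<bar>f y - f x\<bar> \<le> e * \<bar>y\<^sup>2 - x\<^sup>2\<bar>" if xy: "max 1 x1 \<le> x" "x < y" for x y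
  proof -
    have "\<exists>z>x. z < y \<and> f y - f x = (y - x) * deriv f z"
      using xy(2) f by (intro MVT2) (auto simp: DERIV_deriv_iff_real_differentiable)
    then obtain z where z: "x < z" "z < y" "f y - f x = (y - x) * deriv f z" by auto
    have "\<bar>f y - f x\<bar> = (y - x) * \<bar>deriv f z\<bar>" using z by (simp add: abs_mult)
    also have "\<dots> \<le> (y - x) * (e * (y + x))"
    proof (intro mult_left_mono)
      have "\<bar>deriv f z\<bar> \<le> e * \<bar>z\<bar>" using z xy by (intro x1) auto
      also have "\<dots> \<le> e * (y + x)" using z xy e by (intro mult_left_mono) auto
      finally show "\<bar>deriv f z\<bar> \<le> e * (y + x)" .
    qed (use xy in auto)
    also have "\<dots> = e * (y\<^sup>2 - x\<^sup>2)" by (simp add: algebra_simps power2_eq_square)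
    also have "\<dots> \<le> e * \<bar>y\<^sup>2 - x\<^sup>2\<bar>" using e by (intro mult_left_mono) auto
    finally show ?thesis .
  qed
  show ?thesis
  proof (intro exI[of _ "max 1 x1"] conjI allI impI)
    fix x y assume "max 1 x1 \<le> x" "max 1 x1 \<le> y"
    then show "\<bar>f x - f y\<bar> \<le> e * \<bar>x\<^sup>2 - y\<^sup>2\<bar>"
      using *[of x y] *[of y x] by (cases x y rule: linorder_cases) (auto simp: abs_minus_commute)
  qed simp
qed

text \<open>With \<open>e = b / 2\<close> in \<open>deriv_small_diff_bound\<close>, the function
  \<open>f\<close> can cancel at most half of the quadratic growth.\<close>

lemma cond_A_plus_at_top:
  assumes "cond_A_plus h b"
  shows "filterlim h at_top at_top"
proof -
  from assms obtain f r where b: "0 < b" and f: "\<And>x. f differentiable (at x)" "deriv f \<in> o[at_top](\<lambda>x. x)"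
    and r: "(r \<longlongrightarrow> 0) at_top" and h: "\<forall>\<^sub>F x in at_top. h x = exp (b * x\<^sup>2 + f x + r x)"
    unfolding cond_A_plus_def by blast
  obtain x0 where x0: "x0 > 0" "\<And>x y. x0 \<le> x \<Longrightarrow> x0 \<le> y \<Longrightarrow> \<bar>f x - f y\<bar> \<le> b / 2 * \<bar>x\<^sup>2 - y\<^sup>2\<bar>"
    using deriv_small_diff_bound[OF f, of "b / 2"] b by auto
  \<comment> \<open>The constant \<open>f x0\<close> is the value from which the increment of
    \<open>f\<close> is measured, and the 1 absorbs \<open>r\<close>, which eventually exceeds
    -1.\<close>
  have "filterlim (\<lambda>x. exp (b / 2 * x\<^sup>2 + (f x0 - 1))) at_top at_top"
    using b by real_asymp
  moreover have "\<forall>\<^sub>F x in at_top. exp (b / 2 * x\<^sup>2 + (f x0 - 1)) \<le> h x"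
    using h order_tendstoD(1)[OF r, of "-1", simplified] eventually_ge_at_top[of x0]
  proof eventually_elim
    case (elim x)
    have "x0\<^sup>2 \<le> x\<^sup>2" using elim x0 by (intro power_mono) auto
    then have "\<bar>f x - f x0\<bar> \<le> b / 2 * (x\<^sup>2 - x0\<^sup>2)"
      using x0(2)[of x x0] elim by simp
    then have "f x \<ge> f x0 - b / 2 * (x\<^sup>2 - x0\<^sup>2)" by linarith
    moreover have "0 \<le> b / 2 * x0\<^sup>2" using b by simp
    ultimately have "b * x\<^sup>2 + f x + r x \<ge> b / 2 * x\<^sup>2 + (f x0 - 1)"
      using elim by (simp add: algebra_simps)
    then show ?case using elim by simp
  qed
  ultimately show ?thesis by (rule filterlim_at_top_mono)
qed

text \<open>Writing the increment of \<open>f\<close> as \<open>\<theta> (p\<^sup>2 - q\<^sup>2)\<close> with \<open>\<theta> \<rightarrow> 0\<close>, the logarithm of the quotient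
  becomes \<open>(b + \<theta>) (p\<^sup>2 - q\<^sup>2) + o(1)\<close>.\<close>

lemma cond_A_plus_square_diff:
  assumes A: "cond_A_plus h b" and p: "filterlim p at_top G" and q: "filterlim q at_top G"
    and c: "0 < c" and quot: "((\<lambda>y. h (p y) / h (q y)) \<longlongrightarrow> c) G"
  shows "((\<lambda>y. (p y)\<^sup>2 - (q y)\<^sup>2) \<longlongrightarrow> ln c / b) G"
proof -
  from A obtain f r where b: "0 < b" and f: "\<And>x. f differentiable (at x)" "deriv f \<in> o[at_top](\<lambda>x. x)"
    and r: "(r \<longlongrightarrow> 0) at_top" and h: "\<forall>\<^sub>F x in at_top. h x = exp (b * x\<^sup>2 + f x + r x)"
    unfolding cond_A_plus_def by blast
  define d where "d y = (p y)\<^sup>2 - (q y)\<^sup>2" for y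
  \<comment> \<open>When \<open>d y = 0\<close>, the bound \<open>small\<close> forces
    \<open>f (p y) = f (q y)\<close>, so the default 0 keeps the factorization \<open>f_eq\<close>
    valid.\<close>
  define \<theta> where "\<theta> y = (if d y = 0 then 0 else (f (p y) - f (q y)) / d y)" for y
  have small: "\<forall>\<^sub>F y in G. \<bar>f (p y) - f (q y)\<bar> \<le> e * \<bar>d y\<bar>" if "0 < e" for e
  proof -
    obtain x0 where "\<And>x y. x0 \<le> x \<Longrightarrow> x0 \<le> y \<Longrightarrow> \<bar>f x - f y\<bar> \<le> e * \<bar>x\<^sup>2 - y\<^sup>2\<bar>"
      using deriv_small_diff_bound[OF f \<open>0 < e\<close>] by auto
    moreover have "\<forall>\<^sub>F y in G. x0 \<le> p y" "\<forall>\<^sub>F y in G. x0 \<le> q y"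
      using p q by (auto simp: filterlim_at_top)
    ultimately show ?thesis unfolding d_def by (auto elim: eventually_elim2)
  qed
  have f_eq: "\<forall>\<^sub>F y in G. f (p y) - f (q y) = \<theta> y * d y"
    using small[OF zero_less_one] by eventually_elim (auto simp: \<theta>_def)
  have \<theta>: "(\<theta> \<longlongrightarrow> 0) G"
  proof (rule tendstoI)
    fix e :: real assume "0 < e"
    have "\<forall>\<^sub>F y in G. \<bar>f (p y) - f (q y)\<bar> \<le> e / 2 * \<bar>d y\<bar>" using \<open>0 < e\<close> by (intro small) auto
    then show "\<forall>\<^sub>F y in G. dist (\<theta> y) 0 < e"
    proof eventually_elim
      case (elim y)
      then have "\<bar>\<theta> y\<bar> \<le> e / 2"
        using \<open>0 < e\<close> by (auto simp: \<theta>_def divide_le_eq)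
      then show ?case using \<open>0 < e\<close> by simp
    qed
  qed
  have "((\<lambda>y. ln (h (p y) / h (q y)) - (r (p y) - r (q y))) \<longlongrightarrow> ln c - (0 - 0)) G"
    using c by (intro tendsto_intros quot filterlim_compose[OF r] p q) auto
  moreover have "\<forall>\<^sub>F y in G. ln (h (p y) / h (q y)) - (r (p y) - r (q y)) = (b + \<theta> y) * d y"
    using f_eq eventually_compose_filterlim[OF h p] eventually_compose_filterlim[OF h q]
  proof eventually_elim
    case (elim y)
    then have "ln (h (p y) / h (q y)) = (b * (p y)\<^sup>2 + f (p y) + r (p y)) - (b * (q y)\<^sup>2 + f (q y) + r (q y))"
      by (simp add: ln_div)
    then show ?case using elim(1) by (simp add: d_def algebra_simps)
  qed
  ultimately have "((\<lambda>y. (b + \<theta> y) * d y) \<longlongrightarrow> ln c) G"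
    by (simp cong: filterlim_cong)
  then have "((\<lambda>y. (b + \<theta> y) * d y / (b + \<theta> y)) \<longlongrightarrow> ln c / (b + 0)) G"
    using b by (intro tendsto_divide tendsto_add tendsto_const \<theta>) auto
  moreover have "\<forall>\<^sub>F y in G. (b + \<theta> y) * d y / (b + \<theta> y) = d y"
    using order_tendstoD(1)[OF \<theta>, of "-b"] b by (auto elim: eventually_mono)
  ultimately have "(d \<longlongrightarrow> ln c / b) G" by (simp only: add_0_right cong: filterlim_cong)
  then show ?thesis unfolding d_def .
qed

text \<open>\<open>inv h\<close> inverts \<open>h\<close> only on its range, which may be bounded
  below. By the intermediate value theorem and unboundedness above, the range contains every level
  from \<open>h 0\<close> on.\<close>

lemma eventually_in_range:
  fixes h :: "real \<Rightarrow> real"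
  assumes "continuous_on UNIV h" and lim: "filterlim h at_top at_top"
  shows "\<forall>\<^sub>F y in at_top. h (inv h y) = y"
  using eventually_ge_at_top[of "h 0"]
proof eventually_elim
  case (elim y)
  obtain x where x: "0 \<le> x" "y \<le> h x"
    using lim unfolding filterlim_at_top eventually_at_top_linorder by (metis linorder_le_cases order_refl)
  have "\<exists>z\<ge>0. z \<le> x \<and> h z = y"
    using elim x assms(1) by (intro IVT') (auto intro: continuous_on_subset)
  then show ?case by (metis f_inv_into_f rangeI)
qed

lemma inv_at_top:
  fixes h :: "real \<Rightarrow> real"
  assumes h: "strict_mono h" "continuous_on UNIV h" and lim: "filterlim h at_top at_top"
  shows "filterlim (inv h) at_top at_top"
  unfolding filterlim_at_top
proof
  fix K
  show "\<forall>\<^sub>F y in at_top. K \<le> inv h y"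
    using eventually_in_range[OF h(2) lim] eventually_ge_at_top[of "h K"]
    by eventually_elim (metis h(1) strict_mono_less_eq)
qed

lemma filterlim_cmult_at_top:
  fixes c :: real
  assumes "0 < c" shows "filterlim (\<lambda>y. c * y) at_top at_top"
  using assms by real_asymp

lemma inv_square_diff:
  fixes h :: "real \<Rightarrow> real"
  assumes h: "strict_mono h" "continuous_on UNIV h" and A: "cond_A_plus h b" and c: "0 < c"
  shows "((\<lambda>y. (inv h (c * y))\<^sup>2 - (inv h y)\<^sup>2) \<longlongrightarrow> ln c / b) at_top"
proof (rule cond_A_plus_square_diff[OF A _ _ c])
  note lim = cond_A_plus_at_top[OF A]
  note cy = filterlim_cmult_at_top[OF c]
  show "filterlim (\<lambda>y. inv h (c * y)) at_top at_top"
    by (rule filterlim_compose[OF inv_at_top[OF h lim] cy])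
  show "filterlim (\<lambda>y. inv h y) at_top at_top" by (rule inv_at_top[OF h lim])
  note ev = eventually_in_range[OF h(2) lim]
  have "\<forall>\<^sub>F y in at_top. h (inv h (c * y)) / h (inv h y) = c"
    using ev eventually_compose_filterlim[OF ev cy] eventually_gt_at_top[of 0]
    by eventually_elim simp
  then show "((\<lambda>y. h (inv h (c * y)) / h (inv h y)) \<longlongrightarrow> c) at_top"
    by (rule tendsto_eventually)
qed

lemma normal_law_tail_eq:
  fixes h :: "real \<Rightarrow> real"
  assumes h: "strict_mono h" "continuous_on UNIV h" and lim: "filterlim h at_top at_top"
  shows "\<forall>\<^sub>F y in at_top. measure (normal_law \<mu> \<sigma>) {x. h x > y} = normal_tail \<mu> \<sigma> (inv h y)"
  using eventually_in_range[OF h(2) lim]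
proof eventually_elim
  case (elim y)
  have "{x. h x > y} = {inv h y<..}"
    using strict_mono_less[OF h(1), of "inv h y"] elim by auto
  then show ?case by (simp add: normal_tail_def)
qed

text \<open>This is the origin of the index: multiplying the level by c raises the square of the
  preimage by \<open>ln c / b\<close> in the limit, and that costs the Gaussian tail the factor
  \<open>exp (- (ln c / b / (2 * \<sigma>\<^sup>2)))\<close>.\<close>

lemma normal_law_tail_ratio:
  fixes h :: "real \<Rightarrow> real"
  assumes h: "strict_mono h" "continuous_on UNIV h" and A: "cond_A_plus h b" and c: "0 < c" and \<sigma>: "0 < \<sigma>"
  shows "((\<lambda>y. measure (normal_law \<mu> \<sigma>) {x. h x > c * y} / measure (normal_law \<mu> \<sigma>) {x. h x > y})
    \<longlongrightarrow> c powr (- (1 / (2 * b * \<sigma>\<^sup>2)))) at_top"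
proof -
  note lim = cond_A_plus_at_top[OF A]
  note cy = filterlim_cmult_at_top[OF c]
  note ev = normal_law_tail_eq[OF h lim, of \<mu> \<sigma>]
  have "exp (- (ln c / b / (2 * \<sigma>\<^sup>2))) = c powr (- (1 / (2 * b * \<sigma>\<^sup>2)))"
    using c by (simp add: powr_def mult_ac)
  moreover have "((\<lambda>y. normal_tail \<mu> \<sigma> (inv h (c * y)) / normal_tail \<mu> \<sigma> (inv h y)) \<longlongrightarrow> exp (- (ln c / b / (2 * \<sigma>\<^sup>2)))) at_top"
    by (intro normal_tail_ratio(1)[OF \<sigma>] inv_square_diff[OF h A c] inv_at_top[OF h lim]
         filterlim_compose[OF inv_at_top[OF h lim] cy])
  moreover have "\<forall>\<^sub>F y in at_top. normal_tail \<mu> \<sigma> (inv h (c * y)) / normal_tail \<mu> \<sigma> (inv h y) =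
    measure (normal_law \<mu> \<sigma>) {x. h x > c * y} / measure (normal_law \<mu> \<sigma>) {x. h x > y}"
    using ev eventually_compose_filterlim[OF ev cy] by eventually_elim simp
  ultimately show ?thesis by (simp cong: filterlim_cong)
qed

lemma regularly_varyingI:
  assumes meas: "g \<in> borel_measurable borel" and pos: "\<forall>\<^sub>F y in at_top. 0 < g y"
    and ratio: "\<And>c. 0 < c \<Longrightarrow> ((\<lambda>y. g (c * y) / g y) \<longlongrightarrow> c powr \<gamma>) at_top"
  shows "regularly_varying \<gamma> g"
  unfolding regularly_varying_def slowly_varying_def
proof (intro exI conjI allI impI)
  let ?L = "\<lambda>y. g y * y powr (- \<gamma>)"
  show "?L \<in> borel_measurable borel" using meas by measurable
  show "\<forall>\<^sub>F y in at_top. 0 < ?L y"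
    using pos eventually_gt_at_top[of 0] by eventually_elim simp
  show "g y = y powr \<gamma> * ?L y" if "0 < y" for y
    using that by (simp add: powr_minus)
  fix c :: real assume c: "0 < c"
  have "((\<lambda>y. g (c * y) / g y * c powr (- \<gamma>)) \<longlongrightarrow> c powr \<gamma> * c powr (- \<gamma>)) at_top"
    by (intro tendsto_mult_right ratio c)
  moreover have "\<forall>\<^sub>F y in at_top. g (c * y) / g y * c powr (- \<gamma>) = ?L (c * y) / ?L y"
    using eventually_gt_at_top[of 0]
    by eventually_elim (use c in \<open>simp add: powr_mult\<close>)
  moreover have "c powr \<gamma> * c powr (- \<gamma>) = 1"
    using c by (simp add: powr_minus)
  ultimately show "((\<lambda>y. ?L (c * y) / ?L y) \<longlongrightarrow> 1) at_top"
    using Lim_transform_eventually by fastforce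
qed

lemma normal_law_tail_pos:
  fixes h :: "real \<Rightarrow> real"
  assumes h: "strict_mono h" "continuous_on UNIV h" and lim: "filterlim h at_top at_top" and \<sigma>: "0 < \<sigma>"
  shows "\<forall>\<^sub>F y in at_top. 0 < measure (normal_law \<mu> \<sigma>) {x. h x > y}"
proof -
  have "\<forall>\<^sub>F y in at_top. \<mu> < inv h y"
    using inv_at_top[OF h lim] by (simp add: filterlim_at_top_dense)
  then show ?thesis
    using normal_law_tail_eq[OF h lim, of \<mu> \<sigma>] by eventually_elim (simp add: normal_tail_pos \<sigma>)
qed

theorem normal_law_tail_regularly_varying:
  fixes h :: "real \<Rightarrow> real"
  assumes h: "strict_mono h" "continuous_on UNIV h" and A: "cond_A_plus h b" and \<sigma>: "0 < \<sigma>"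
  shows "regularly_varying (- (1 / (2 * b * \<sigma>\<^sup>2))) (\<lambda>y. measure (normal_law \<mu> \<sigma>) {x. h x > y})"
proof (rule regularly_varyingI)
  interpret real_distribution "normal_law \<mu> \<sigma>" by (rule real_distribution_normal_law[OF \<sigma>])
  have [measurable]: "h \<in> borel_measurable borel"
    by (rule borel_measurable_continuous_onI[OF h(2)])
  \<comment> \<open>The tail is antitone; its negative is monotone and hence Borel.\<close>
  have "mono (\<lambda>y. - measure (normal_law \<mu> \<sigma>) {x. h x > y})"
    by (intro monoI) (auto intro!: finite_measure_mono)
  then have "(\<lambda>y. - (- measure (normal_law \<mu> \<sigma>) {x. h x > y})) \<in> borel_measurable borel"
    by (intro borel_measurable_uminus borel_measurable_mono)
  then show "(\<lambda>y. measure (normal_law \<mu> \<sigma>) {x. h x > y}) \<in> borel_measurable borel" by simp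
  show "\<forall>\<^sub>F y in at_top. 0 < measure (normal_law \<mu> \<sigma>) {x. h x > y}"
    by (rule normal_law_tail_pos[OF h cond_A_plus_at_top[OF A] \<sigma>])
qed (rule normal_law_tail_ratio[OF h A _ \<sigma>])

section \<open>Left tails by reflection\<close>

lemma reflect_strict_mono:
  fixes h :: "real \<Rightarrow> real"
  assumes "strict_mono h" shows "strict_mono (\<lambda>x. - h (- x))"
  using assms by (auto simp: strict_mono_def)

lemma reflect_continuous:
  fixes h :: "real \<Rightarrow> real"
  assumes "continuous_on UNIV h" shows "continuous_on UNIV (\<lambda>x. - h (- x))"
  by (intro continuous_intros continuous_on_compose2[OF assms]) auto

text \<open>The quadratic term is even, so \<open>f (- x)\<close> and \<open>r (- x)\<close> are the
  new witnesses; the sign change of the derivative does not affect its being o(x).\<close>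

lemma cond_A_minus_reflect:
  assumes "cond_A_minus h b"
  shows "cond_A_plus (\<lambda>x. - h (- x)) b"
proof -
  from assms obtain f r where b: "0 < b" and f: "\<And>x. f differentiable (at x)" "deriv f \<in> o[at_bot](\<lambda>x. x)"
    and r: "(r \<longlongrightarrow> 0) at_bot" and h: "\<forall>\<^sub>F x in at_bot. h x = - exp (b * x\<^sup>2 + f x + r x)"
    unfolding cond_A_minus_def by blast
  let ?f = "\<lambda>x. f (- x)" and ?r = "\<lambda>x. r (- x)"
  have D: "DERIV ?f x :> - deriv f (- x)" for x
  proof -
    have "DERIV f (- x) :> deriv f (- x)"
      using f(1) by (simp add: DERIV_deriv_iff_real_differentiable)
    moreover have "DERIV uminus x :> (- 1 :: real)"
      by (auto intro!: derivative_eq_intros)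
    ultimately show ?thesis
      using DERIV_chain2[of f "deriv f (- x)" uminus x "-1" UNIV] by simp
  qed
  show ?thesis
    unfolding cond_A_plus_def
  proof (rule conjI[OF b], rule exI[of _ ?f], rule exI[of _ ?r], intro conjI allI)
    show "?f differentiable (at x)" for x
      using D real_differentiable_def by blast
    have "deriv ?f = (\<lambda>x. - deriv f (- x))"
      using D by (auto intro: DERIV_imp_deriv)
    moreover have "(\<lambda>x. - deriv f (- x)) \<in> o[at_top](\<lambda>x. x)"
    proof -
      have "(\<lambda>x. deriv f (- x)) \<in> o[at_top](\<lambda>x. - x)"
        by (rule landau_o.small.compose[OF f(2) filterlim_uminus_at_bot_at_top])
      then show ?thesis by simp
    qed
    ultimately show "deriv ?f \<in> o[at_top](\<lambda>x. x)" by simp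
    show "(?r \<longlongrightarrow> 0) at_top" by (rule filterlim_compose[OF r filterlim_uminus_at_bot_at_top])
    show "\<forall>\<^sub>F x in at_top. - h (- x) = exp (b * x\<^sup>2 + ?f x + ?r x)"
      using eventually_compose_filterlim[OF h filterlim_uminus_at_bot_at_top]
      by eventually_elim simp
  qed
qed

text \<open>On the probability space \<open>normal_law \<mu> \<sigma>\<close> the identity map is
  itself a normal variable, so \<open>normal_density_affine\<close> with factor -1 applies to it.
  The same device serves for scaling in \<open>char_normal_law\<close> and for shifting in
  \<open>normal_transition_kernel\<close>.\<close>

lemma distr_uminus_normal_law:
  assumes "0 < \<sigma>"
  shows "distr (normal_law \<mu> \<sigma>) lborel uminus = normal_law (- \<mu>) \<sigma>"
proof -
  interpret prob_space "normal_law \<mu> \<sigma>" by (rule prob_space_normal_density[OF assms])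
  have "distributed (normal_law \<mu> \<sigma>) lborel (\<lambda>x. x) (normal_density \<mu> \<sigma>)"
    by (auto simp: distributed_def intro!: distr_id2)
  from normal_density_affine[OF this assms, of "-1" 0] show ?thesis
    by (auto simp: distributed_def)
qed

text \<open>Reflection turns the inequality that defines the distribution function into a non-strict
  one, whereas right tails are strict. The two events differ by a level set of \<open>h\<close>,
  which has at most one point because \<open>h\<close> is strictly increasing.\<close>

lemma normal_law_left_tail:
  fixes h :: "real \<Rightarrow> real"
  assumes h: "strict_mono h" "continuous_on UNIV h" and \<sigma>: "0 < \<sigma>"
  shows "measure (normal_law \<mu> \<sigma>) {x. h x \<le> - y} = measure (normal_law (- \<mu>) \<sigma>) {x. - h (- x) > y}"
proof -
  interpret real_distribution "normal_law \<mu> \<sigma>" by (rule real_distribution_normal_law[OF \<sigma>])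
  have [measurable]: "h \<in> borel_measurable borel"
    by (rule borel_measurable_continuous_onI[OF h(2)])
  have [measurable]: "{x. - h (- x) > y} \<in> sets borel" by measurable
  have "measure (normal_law (- \<mu>) \<sigma>) {x. - h (- x) > y} = measure (normal_law \<mu> \<sigma>) {x. h x < - y}"
    unfolding distr_uminus_normal_law[OF \<sigma>, symmetric]
    by (subst measure_distr) (auto intro!: arg_cong[where f="measure _"] simp: less_minus_iff)
  also have "\<dots> = measure (normal_law \<mu> \<sigma>) {x. h x \<le> - y}"
  proof (rule finite_measure_eq_AE)
    have "AE x in lborel. h x \<noteq> - y"
    proof (cases "- y \<in> range h")
      case True
      then obtain z where "h z = - y" by auto
      then have "h x \<noteq> - y" if "x \<noteq> z" for x
        using that strict_mono_eq[OF h(1), of x z] by auto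
      then show ?thesis using AE_lborel_singleton[of z] by auto
    next
      case False
      then have "h x \<noteq> - y" for x by (metis rangeI)
      then show ?thesis by simp
    qed
    then show "AE x in normal_law \<mu> \<sigma>. x \<in> {x. h x < - y} \<longleftrightarrow> x \<in> {x. h x \<le> - y}"
      by (subst AE_density) auto
  qed auto
  finally show ?thesis ..
qed

theorem normal_law_left_tail_regularly_varying:
  fixes h :: "real \<Rightarrow> real"
  assumes h: "strict_mono h" "continuous_on UNIV h" and A: "cond_A_minus h b" and \<sigma>: "0 < \<sigma>"
  shows "regularly_varying (- (1 / (2 * b * \<sigma>\<^sup>2))) (\<lambda>y. measure (normal_law \<mu> \<sigma>) {x. h x \<le> - y})"
  unfolding normal_law_left_tail[OF h \<sigma>]
  by (intro normal_law_tail_regularly_varying reflect_strict_mono reflect_continuous cond_A_minus_reflect h A \<sigma>)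

section \<open>The Ornstein-Uhlenbeck process\<close>

text \<open>Eliminating the noise through the equation shows that the left-hand difference equals
  the integral over \<open>{u..v}\<close> of \<open>\<alpha> * (exp (\<alpha> * s) * x v - exp
  (\<alpha> * u) * x s)\<close>. On a short interval this integrand is small by continuity of the
  path, and the length of the interval supplies the second small factor.\<close>

lemma OU_increment_bound:
  fixes x w :: "real \<Rightarrow> real"
  assumes \<alpha>: "0 < \<alpha>" and cont: "continuous_on {0..} x"
    and eq: "\<And>t. 0 \<le> t \<Longrightarrow> x t = x 0 - \<alpha> * integral {0..t} x + \<tau> * w t"
    and uv: "0 \<le> u" "u \<le> v"
    and bound: "\<And>s. u \<le> s \<Longrightarrow> s \<le> v \<Longrightarrow> \<bar>exp (\<alpha> * s) * x v - exp (\<alpha> * u) * x s\<bar> \<le> e"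
  shows "\<bar>(exp (\<alpha> * v) * x v - exp (\<alpha> * u) * x u) - exp (\<alpha> * u) * (\<tau> * (w v - w u))\<bar> \<le> \<alpha> * e * (v - u)"
proof -
  have c0: "continuous_on {0..v} x" and cuv: "continuous_on {u..v} x"
    using uv by (auto intro!: continuous_on_subset[OF cont])
  have "integral {0..u} x + integral {u..v} x = integral {0..v} x"
    by (rule Henstock_Kurzweil_Integration.integral_combine[OF uv integrable_continuous_real[OF c0]])
  then have w: "\<tau> * (w v - w u) = x v - x u + \<alpha> * integral {u..v} x"
  proof -
    have "\<tau> * w u = x u - x 0 + \<alpha> * integral {0..u} x" "\<tau> * w v = x v - x 0 + \<alpha> * integral {0..v} x"
      using eq[of u] eq[of v] uv by linarith+
    then show ?thesis
      unfolding \<open>_ = integral {0..v} x\<close>[symmetric] by (simp only: right_diff_distrib distrib_left)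
  qed
  have "((\<lambda>s. \<alpha> * exp (\<alpha> * s)) has_integral (exp (\<alpha> * v) - exp (\<alpha> * u))) {u..v}"
  proof (rule fundamental_theorem_of_calculus[OF uv(2)])
    fix s
    have "DERIV (\<lambda>s. exp (\<alpha> * s)) s :> exp (\<alpha> * s) * (\<alpha> * 1)"
      by (intro DERIV_fun_exp DERIV_cmult DERIV_ident)
    then have "DERIV (\<lambda>s. exp (\<alpha> * s)) s :> \<alpha> * exp (\<alpha> * s)"
      by (simp add: mult.commute)
    then show "((\<lambda>s. exp (\<alpha> * s)) has_vector_derivative \<alpha> * exp (\<alpha> * s)) (at s within {u..v})"
      by (rule has_vector_derivative_at_within[OF has_real_derivative_iff_has_vector_derivative[THEN iffD1]])
  qed
  from has_integral_mult_left[OF this, of "x v"]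
  have "((\<lambda>s. \<alpha> * exp (\<alpha> * s) * x v - \<alpha> * exp (\<alpha> * u) * x s) has_integral
    ((exp (\<alpha> * v) - exp (\<alpha> * u)) * x v - \<alpha> * exp (\<alpha> * u) * integral {u..v} x)) {u..v}"
    by (rule has_integral_diff[OF _ has_integral_mult_right[OF integrable_integral[OF integrable_continuous_real[OF cuv]]]])
  then have "integral {u..v} (\<lambda>s. \<alpha> * exp (\<alpha> * s) * x v - \<alpha> * exp (\<alpha> * u) * x s) =
    (exp (\<alpha> * v) - exp (\<alpha> * u)) * x v - \<alpha> * exp (\<alpha> * u) * integral {u..v} x"
    by (rule integral_unique)
  also have "\<dots> = (exp (\<alpha> * v) * x v - exp (\<alpha> * u) * x u) - exp (\<alpha> * u) * (\<tau> * (w v - w u))"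
    by (simp only: w) (simp add: algebra_simps)
  finally have "\<bar>(exp (\<alpha> * v) * x v - exp (\<alpha> * u) * x u) - exp (\<alpha> * u) * (\<tau> * (w v - w u))\<bar> =
    norm (integral {u..v} (\<lambda>s. \<alpha> * exp (\<alpha> * s) * x v - \<alpha> * exp (\<alpha> * u) * x s))" by simp
  also have "\<dots> \<le> \<alpha> * e * (v - u)"
  proof (rule integral_bound[OF uv(2)])
    show "continuous_on {u..v} (\<lambda>s. \<alpha> * exp (\<alpha> * s) * x v - \<alpha> * exp (\<alpha> * u) * x s)"
      by (intro continuous_on_diff continuous_on_mult continuous_on_exp continuous_on_const continuous_on_id cuv)
    fix s assume s: "s \<in> {u..v}"
    have "\<alpha> * exp (\<alpha> * s) * x v - \<alpha> * exp (\<alpha> * u) * x s = \<alpha> * (exp (\<alpha> * s) * x v - exp (\<alpha> * u) * x s)"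
      by (simp add: algebra_simps)
    moreover have "\<bar>\<alpha> * (exp (\<alpha> * s) * x v - exp (\<alpha> * u) * x s)\<bar> \<le> \<alpha> * e"
      unfolding abs_mult using \<alpha> s by (intro mult_mono bound) auto
    ultimately show "norm (\<alpha> * exp (\<alpha> * s) * x v - \<alpha> * exp (\<alpha> * u) * x s) \<le> \<alpha> * e"
      by (simp only: real_norm_def)
  qed
  finally show ?thesis .
qed

text \<open>The increments of \<open>exp (\<alpha> * t) * x t\<close> telescope, and the errors from
  \<open>OU_increment_bound\<close> add up to a multiple of T. Convergence is therefore pathwise,
  and no stochastic integral appears.\<close>

lemma OU_riemann_sum:
  fixes x w :: "real \<Rightarrow> real"
  assumes \<alpha>: "0 < \<alpha>" and cont: "continuous_on {0..} x"
    and eq: "\<And>t. 0 \<le> t \<Longrightarrow> x t = x 0 - \<alpha> * integral {0..t} x + \<tau> * w t"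
    and T: "0 < T"
  shows "(\<lambda>n. \<Sum>i<n. exp (\<alpha> * (real i * (T / real n))) * (\<tau> * (w (real (Suc i) * (T / real n)) - w (real i * (T / real n)))))
    \<longlonglongrightarrow> exp (\<alpha> * T) * x T - x 0"
proof (rule LIMSEQ_I)
  fix e :: real assume "0 < e"
  \<comment> \<open>Chosen so that the total error \<open>\<alpha> * e' * T\<close> is
    \<open>e / 2\<close>.\<close>
  define e' where "e' = e / (2 * \<alpha> * T)"
  have e': "0 < e'" using \<open>0 < e\<close> \<alpha> T by (simp add: e'_def)
  \<comment> \<open>The bound evaluates the exponential and the path at different times, namely at
    the pairs (s, v) and (u, s), so uniform continuity is needed for a function of two variables.
    These pairs are at most v - u apart.\<close>
  have "continuous_on ({0..T} \<times> {0..T}) (\<lambda>p. exp (\<alpha> * fst p) * x (snd p))"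
    by (intro continuous_on_mult continuous_on_exp continuous_on_const continuous_on_fst continuous_on_id
        continuous_on_compose2[OF cont continuous_on_snd[OF continuous_on_id]]) auto
  then have "uniformly_continuous_on ({0..T} \<times> {0..T}) (\<lambda>p. exp (\<alpha> * fst p) * x (snd p))"
    by (intro compact_uniformly_continuous compact_Times compact_Icc)
  then obtain d where d: "0 < d" and
    D: "\<And>p q. p \<in> {0..T} \<times> {0..T} \<Longrightarrow> q \<in> {0..T} \<times> {0..T} \<Longrightarrow> dist q p < d \<Longrightarrow>
      dist (exp (\<alpha> * fst q) * x (snd q)) (exp (\<alpha> * fst p) * x (snd p)) < e'"
    unfolding uniformly_continuous_on_def using e' by metis
  obtain n0 where n0: "2 * T / d < real n0" using reals_Archimedean2 by blast
  have "0 < 2 * T / d" using T d by simp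
  then have n0pos: "0 < real n0" using n0 by linarith
  show "\<exists>no. \<forall>n\<ge>no. norm ((\<Sum>i<n. exp (\<alpha> * (real i * (T / real n))) * (\<tau> * (w (real (Suc i) * (T / real n)) - w (real i * (T / real n)))))
    - (exp (\<alpha> * T) * x T - x 0)) < e"
  proof (intro exI allI impI)
    fix n assume "n \<ge> n0"
    then have n: "0 < real n" and "2 * T / d < real n" using n0 n0pos by auto
    define k where "k = T / real n"
    have k: "0 < k" "2 * k < d" "real n * k = T"
      using n T d \<open>2 * T / d < real n\<close> by (auto simp: k_def field_simps)
    let ?m = "\<lambda>i. exp (\<alpha> * (real i * k)) * x (real i * k)"
    let ?s = "\<lambda>i. exp (\<alpha> * (real i * k)) * (\<tau> * (w (real (Suc i) * k) - w (real i * k)))"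
    have inc: "\<bar>(?m (Suc i) - ?m i) - ?s i\<bar> \<le> \<alpha> * e' * k" if i: "i < n" for i
    proof -
      have le: "real i * k \<le> real (Suc i) * k" using k by (intro mult_right_mono) auto
      have Sn: "real (Suc i) * k \<le> T"
        unfolding k(3)[symmetric] using k(1) i by (intro mult_right_mono) auto
      have "\<bar>(?m (Suc i) - ?m i) - ?s i\<bar> \<le> \<alpha> * e' * (real (Suc i) * k - real i * k)"
      proof (rule OU_increment_bound[OF \<alpha> cont eq])
        fix s assume s: "real i * k \<le> s" "s \<le> real (Suc i) * k"
        have "0 \<le> real i * k" using k by simp
        have "dist (s, real (Suc i) * k) (real i * k, s) \<le> \<bar>s - real i * k\<bar> + \<bar>real (Suc i) * k - s\<bar>"
          by (simp add: dist_Pair_Pair dist_real_def) (rule order_trans[OF sqrt_sum_squares_le_sum_abs], simp)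
        also have "\<dots> = k" using s by (simp add: algebra_simps)
        also have "\<dots> < d" using k by simp
        finally have "dist (exp (\<alpha> * s) * x (real (Suc i) * k)) (exp (\<alpha> * (real i * k)) * x s) < e'"
          using D[of "(real i * k, s)" "(s, real (Suc i) * k)"] s Sn le \<open>0 \<le> real i * k\<close> by auto
        then show "\<bar>exp (\<alpha> * s) * x (real (Suc i) * k) - exp (\<alpha> * (real i * k)) * x s\<bar> \<le> e'"
          by (simp add: dist_real_def)
      qed (use k le in auto)
      then show ?thesis by (simp add: algebra_simps)
    qed
    have "(\<Sum>i<n. ?m (Suc i) - ?m i) = exp (\<alpha> * T) * x T - x 0"
      by (subst sum_lessThan_telescope) (simp add: k(3))
    then have "\<bar>(\<Sum>i<n. ?s i) - (exp (\<alpha> * T) * x T - x 0)\<bar> = \<bar>\<Sum>i<n. (?m (Suc i) - ?m i) - ?s i\<bar>"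
      by (simp add: sum_subtractf abs_minus_commute)
    also have "\<dots> \<le> (\<Sum>i<n. \<alpha> * e' * k)"
      by (rule order_trans[OF sum_abs]) (intro sum_mono inc, simp)
    also have "\<dots> = \<alpha> * e' * T" using k(3) by (simp add: mult_ac)
    also have "\<dots> < e" using \<alpha> T \<open>0 < e\<close> by (simp add: e'_def)
    finally show "norm ((\<Sum>i<n. exp (\<alpha> * (real i * (T / real n))) * (\<tau> * (w (real (Suc i) * (T / real n)) - w (real i * (T / real n)))))
      - (exp (\<alpha> * T) * x T - x 0)) < e" by (simp add: k_def)
  qed
qed

section \<open>Gaussian limits and the innovation from time 0\<close>

lemma char_normal_law:
  assumes "0 < \<sigma>"
  shows "char (normal_law 0 \<sigma>) t = of_real (exp (- ((\<sigma> * t)\<^sup>2 / 2)))"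
proof -
  interpret prob_space "std_normal_distribution" by (rule prob_space_normal_density) simp
  have "distributed std_normal_distribution lborel (\<lambda>x. x) (normal_density 0 1)"
    by (auto simp: distributed_def intro!: distr_id2)
  from normal_density_affine[OF this, of \<sigma> 0] assms
  have "normal_law 0 \<sigma> = distr std_normal_distribution lborel (\<lambda>x. \<sigma> * x)"
    by (auto simp: distributed_def)
  then have "char (normal_law 0 \<sigma>) t = char std_normal_distribution (\<sigma> * t)"
    by (simp add: char_def integral_distr mult_ac)
  then show ?thesis by (simp add: char_std_normal_distribution)
qed

text \<open>Dominated convergence, since \<open>iexp\<close> has modulus 1. It serves twice: for the
  sums that approximate the innovation, and for the weak continuity of the transition
  kernel.\<close>

lemma (in prob_space) char_tendsto_AE:
  assumes S[measurable]: "\<And>n. S n \<in> borel_measurable M" and N[measurable]: "N \<in> borel_measurable M"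
    and lim: "AE \<omega> in M. (\<lambda>n. S n \<omega>) \<longlonglongrightarrow> N \<omega>"
  shows "(\<lambda>n. char (distr M borel (S n)) t) \<longlonglongrightarrow> char (distr M borel N) t"
proof -
  have "(\<lambda>n. CLINT \<omega>|M. iexp (t * S n \<omega>)) \<longlonglongrightarrow> (CLINT \<omega>|M. iexp (t * N \<omega>))"
  proof (rule integral_dominated_convergence[where w = "\<lambda>_. 1"])
    show "AE \<omega> in M. (\<lambda>n. iexp (t * S n \<omega>)) \<longlonglongrightarrow> iexp (t * N \<omega>)"
      using lim by eventually_elim (intro tendsto_intros)
  qed auto
  then show ?thesis by (simp add: char_def integral_distr)
qed

text \<open>The characteristic functions converge along the variables and, explicitly, along the
  standard deviations; the common limit determines the law.\<close>

lemma (in prob_space) normal_limit: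
  assumes S[measurable]: "\<And>n. S n \<in> borel_measurable M" and N[measurable]: "N \<in> borel_measurable M"
    and lim: "AE \<omega> in M. (\<lambda>n. S n \<omega>) \<longlonglongrightarrow> N \<omega>"
    and normal: "\<And>n. distr M borel (S n) = normal_law 0 (s n)"
    and s: "\<And>n. 0 < s n" "s \<longlonglongrightarrow> s'" "0 < s'"
  shows "distr M borel N = normal_law 0 s'"
proof (rule Levy_uniqueness)
  show "real_distribution (distr M borel N)" by (rule real_distribution_distr) simp
  show "real_distribution (normal_law 0 s')" by (rule real_distribution_normal_law[OF s(3)])
  show "char (distr M borel N) = char (normal_law 0 s')"
  proof
    fix t
    have "(\<lambda>n. char (distr M borel (S n)) t) \<longlonglongrightarrow> char (normal_law 0 s') t"
      unfolding normal char_normal_law[OF s(1)] char_normal_law[OF s(3)]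
      by (intro tendsto_intros s) auto
    with char_tendsto_AE[OF S N lim] show "char (distr M borel N) t = char (normal_law 0 s') t"
      by (rule LIMSEQ_unique)
  qed
qed

text \<open>The summands are the variances of the weighted Wiener increments in
  \<open>stationary_OU_innovation\<close>. They form a geometric progression with ratio
  \<open>exp z\<close> for \<open>z = 2 * \<alpha> * T / real n\<close>, and its sum is a constant
  times \<open>z / (exp z - 1)\<close>, which tends to that constant.\<close>

lemma OU_variance_sum:
  fixes \<alpha> \<tau> T :: real
  assumes "0 < \<alpha>" "0 < \<tau>" "0 < T"
  shows "(\<lambda>n. \<Sum>i<n. (exp (- (\<alpha> * T)) * exp (\<alpha> * (real i * (T / real n))) * \<tau> * sqrt (T / real n))\<^sup>2)
    \<longlonglongrightarrow> \<tau>\<^sup>2 / (2 * \<alpha>) * (1 - exp (- 2 * \<alpha> * T))"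
proof -
  have lim: "(\<lambda>n. exp (- (2 * \<alpha> * T)) * \<tau>\<^sup>2 * (exp (2 * \<alpha> * T) - 1) * ((T / real n) / (exp (2 * \<alpha> * T / real n) - 1)))
    \<longlonglongrightarrow> exp (- (2 * \<alpha> * T)) * \<tau>\<^sup>2 * (exp (2 * \<alpha> * T) - 1) * (1 / (2 * \<alpha>))"
  proof (intro tendsto_mult_left)
    define k where "k = 2 * \<alpha> * T"
    have k: "0 < k" using assms by (simp add: k_def)
    have "((\<lambda>z::real. z / (exp z - 1)) \<longlongrightarrow> 1) (at_right 0)"
      by real_asymp
    moreover have "filterlim (\<lambda>n. k / real n) (at_right 0) sequentially"
      using k by real_asymp
    ultimately have "(\<lambda>n. (k / real n) / (exp (k / real n) - 1)) \<longlonglongrightarrow> 1"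
      by (rule filterlim_compose)
    from tendsto_mult_left[OF this, of "1 / (2 * \<alpha>)"]
    show "(\<lambda>n. (T / real n) / (exp (2 * \<alpha> * T / real n) - 1)) \<longlonglongrightarrow> 1 / (2 * \<alpha>)"
      using assms by (simp add: k_def)
  qed
  have eq: "exp (- (2 * \<alpha> * T)) * \<tau>\<^sup>2 * (exp (2 * \<alpha> * T) - 1) * (1 / (2 * \<alpha>)) = \<tau>\<^sup>2 / (2 * \<alpha>) * (1 - exp (- 2 * \<alpha> * T))"
    by (simp add: algebra_simps exp_minus diff_divide_distrib)
  have "\<forall>\<^sub>F n in sequentially. exp (- (2 * \<alpha> * T)) * \<tau>\<^sup>2 * (exp (2 * \<alpha> * T) - 1) * ((T / real n) / (exp (2 * \<alpha> * T / real n) - 1)) =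
    (\<Sum>i<n. (exp (- (\<alpha> * T)) * exp (\<alpha> * (real i * (T / real n))) * \<tau> * sqrt (T / real n))\<^sup>2)"
    using eventually_gt_at_top[of 0]
  proof eventually_elim
    case (elim n)
    define q where "q = exp (2 * \<alpha> * T / real n)"
    have q: "q \<noteq> 1" using assms elim by (simp add: q_def)
    have "(exp (- (\<alpha> * T)) * exp (\<alpha> * (real i * (T / real n))) * \<tau> * sqrt (T / real n))\<^sup>2 =
      exp (- (2 * \<alpha> * T)) * \<tau>\<^sup>2 * (T / real n) * q ^ i" for i
    proof -
      have "(exp (- (\<alpha> * T)))\<^sup>2 = exp (- (2 * \<alpha> * T))" by (simp add: exp_of_nat_mult[symmetric])
      moreover have "(exp (\<alpha> * (real i * (T / real n))))\<^sup>2 = q ^ i"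
        unfolding q_def exp_of_nat_mult[symmetric] by (simp add: mult_ac)
      moreover have "(sqrt (T / real n))\<^sup>2 = T / real n" using assms by simp
      ultimately show ?thesis by (simp only: power_mult_distrib mult_ac)
    qed
    then have "(\<Sum>i<n. (exp (- (\<alpha> * T)) * exp (\<alpha> * (real i * (T / real n))) * \<tau> * sqrt (T / real n))\<^sup>2) =
      exp (- (2 * \<alpha> * T)) * \<tau>\<^sup>2 * (T / real n) * ((q ^ n - 1) / (q - 1))"
      by (simp only: sum_distrib_left[symmetric] geometric_sum[OF q])
    moreover have "q ^ n = exp (2 * \<alpha> * T)"
      unfolding q_def exp_of_nat_mult[symmetric] using elim by simp
    ultimately show ?case by (simp add: q_def)
  qed
  from Lim_transform_eventually[OF lim this] show ?thesis unfolding eq .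
qed

text \<open>\<open>Z\<close> must be a function of the Wiener path alone, for its independence of
  \<open>X 0\<close> comes from the independence of whole sigma-algebras. Hence it is defined as the
  limit of the sums, and is identified with the difference involving \<open>X T\<close> only almost
  surely.\<close>

lemma stationary_OU_innovation:
  assumes \<alpha>: "0 < \<alpha>" and \<tau>: "0 < \<tau>" and OU: "stationary_OU M \<alpha> \<tau> X" and T: "0 < T"
  shows "\<exists>Z. prob_space.indep_var M borel (X 0) borel Z \<and>
    distr M borel Z = normal_law 0 (sqrt (\<tau>\<^sup>2 / (2 * \<alpha>) * (1 - exp (- 2 * \<alpha> * T)))) \<and>
    (AE \<omega> in M. X T \<omega> = exp (- (\<alpha> * T)) * X 0 \<omega> + Z \<omega>)"
proof -
  from OU interpret prob_space M by (simp add: stationary_OU_def)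
  from OU obtain W where W: "wiener_process M W"
    and ind: "indep_set (sets (vimage_algebra (space M) (X 0) borel))
          (sets (vimage_algebra (space M) (\<lambda>\<omega>. \<lambda>t\<in>{0..}. W t \<omega>) (\<Pi>\<^sub>M t\<in>{0..}. borel)))"
    and sol: "AE \<omega> in M. continuous_on {0..} (\<lambda>t. X t \<omega>) \<and>
           (\<forall>t\<ge>0. X t \<omega> = X 0 \<omega> - \<alpha> * integral {0..t} (\<lambda>s. X s \<omega>) + \<tau> * W t \<omega>)"
    and X0: "X 0 \<in> borel_measurable M"
    unfolding stationary_OU_def stationary_process_def by blast
  define V where "V = vimage_algebra (space M) (\<lambda>\<omega>. \<lambda>t\<in>{0..}. W t \<omega>) (\<Pi>\<^sub>M t\<in>{0..}. (borel :: real measure))"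
  \<comment> \<open>With \<open>Suc n\<close> intervals the mesh is positive also for n = 0, so that
    every \<open>S n\<close> is a nondegenerate Gaussian variable, as \<open>normal_limit\<close>
    demands.\<close>
  define k where "k n = T / real (Suc n)" for n
  define c where "c n i = exp (- (\<alpha> * T)) * exp (\<alpha> * (real i * k n)) * \<tau>" for n i
  define D where "D n i \<omega> = W (real (Suc i) * k n) \<omega> - W (real i * k n) \<omega>" for n i \<omega>
  define S where "S n \<omega> = (\<Sum>i<Suc n. c n i * D n i \<omega>)" for n \<omega>
  \<comment> \<open>Where the sums diverge, \<open>lim\<close> has some unspecified value;
    measurability with respect to \<open>V\<close> holds all the same.\<close>
  define Z where "Z \<omega> = lim (\<lambda>n. S n \<omega>)" for \<omega>
  have k: "0 < k n" for n using T by (simp add: k_def)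
  have c: "0 < c n i" for n i using \<tau> by (simp add: c_def)
  have spV: "space V = space M" by (simp add: V_def)
  have setsV: "sets V \<subseteq> sets M" using indep_setD_ev2[OF ind] by (simp add: V_def)
  have WV [measurable]: "W t \<in> borel_measurable V" if "0 \<le> t" for t
  proof -
    have "(\<lambda>\<omega>. \<lambda>t\<in>{0..}. W t \<omega>) \<in> V \<rightarrow>\<^sub>M (\<Pi>\<^sub>M t\<in>{0..}. borel)"
      unfolding V_def by (rule measurable_vimage_algebra1) (auto simp: space_PiM)
    from measurable_compose[OF this measurable_component_singleton[of t]] that
    show ?thesis by simp
  qed
  have DV [measurable]: "D n i \<in> borel_measurable V" for n i
    unfolding D_def[abs_def] using k[of n] by (intro borel_measurable_diff WV) auto
  have SV [measurable]: "S n \<in> borel_measurable V" for n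
    unfolding S_def[abs_def] by measurable
  have ZV: "Z \<in> borel_measurable V"
    unfolding Z_def[abs_def] by (rule borel_measurable_lim_metric) (rule SV)
  have VM: "f \<in> borel_measurable M" if "f \<in> borel_measurable V" for f :: "'a \<Rightarrow> real"
    using that setsV spV by (auto simp: measurable_def)
  have lim: "AE \<omega> in M. (\<lambda>n. S n \<omega>) \<longlonglongrightarrow> X T \<omega> - exp (- (\<alpha> * T)) * X 0 \<omega>"
    using sol
  proof eventually_elim
    case (elim \<omega>)
    then have cont: "continuous_on {0..} (\<lambda>t. X t \<omega>)"
      and eq: "\<And>t. 0 \<le> t \<Longrightarrow> X t \<omega> = X 0 \<omega> - \<alpha> * integral {0..t} (\<lambda>s. X s \<omega>) + \<tau> * W t \<omega>"
      by blast+
    have "(\<lambda>n. \<Sum>i<n. exp (\<alpha> * (real i * (T / real n))) * (\<tau> * (W (real (Suc i) * (T / real n)) \<omega> - W (real i * (T / real n)) \<omega>)))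
      \<longlonglongrightarrow> exp (\<alpha> * T) * X T \<omega> - X 0 \<omega>"
      by (rule OU_riemann_sum[OF \<alpha> cont eq T])
    from tendsto_mult_left[OF LIMSEQ_Suc[OF this], of "exp (- (\<alpha> * T))"]
    have "(\<lambda>n. S n \<omega>) \<longlonglongrightarrow> exp (- (\<alpha> * T)) * (exp (\<alpha> * T) * X T \<omega> - X 0 \<omega>)"
      by (simp only: S_def D_def c_def k_def sum_distrib_left mult.assoc)
    moreover have "exp (- (\<alpha> * T)) * (exp (\<alpha> * T) * X T \<omega> - X 0 \<omega>) = X T \<omega> - exp (- (\<alpha> * T)) * X 0 \<omega>"
      by (simp add: right_diff_distrib mult.assoc[symmetric] exp_add[symmetric])
    ultimately show ?case by simp
  qed
  then have Z: "AE \<omega> in M. Z \<omega> = X T \<omega> - exp (- (\<alpha> * T)) * X 0 \<omega>"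
    by eventually_elim (simp add: Z_def limI)
  have limZ: "AE \<omega> in M. (\<lambda>n. S n \<omega>) \<longlonglongrightarrow> Z \<omega>"
    using lim Z by eventually_elim simp
  have normal: "distr M borel (S n) = normal_law 0 (sqrt (\<Sum>i<Suc n. (c n i * sqrt (k n))\<^sup>2))" for n
  proof -
    \<comment> \<open>\<open>wiener_process\<close> takes an infinite strictly increasing sequence
      of times, so the grid is continued beyond T and only its first \<open>Suc n\<close> increments
      enter.\<close>
    have mono: "strict_mono (\<lambda>i. real i * k n)"
      using k[of n] by (auto simp: strict_mono_def)
    have "indep_vars (\<lambda>_. borel) (\<lambda>i \<omega>. W (t (Suc i)) \<omega> - W (t i) \<omega>) {..<m}"
      if "0 \<le> t 0" "strict_mono t" for t :: "nat \<Rightarrow> real" and m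
      using W that unfolding wiener_process_def by blast
    from this[OF _ mono] have "indep_vars (\<lambda>_. borel) (D n) {..<Suc n}"
      unfolding D_def[abs_def] by simp
    from indep_vars_compose2[OF this, of "\<lambda>i x. c n i * x" "\<lambda>_. borel"]
    have "indep_vars (\<lambda>_. borel) (\<lambda>i \<omega>. c n i * D n i \<omega>) {..<Suc n}" by simp
    moreover have "distributed M lborel (\<lambda>\<omega>. c n i * D n i \<omega>) (normal_density 0 (c n i * sqrt (k n)))" for i
    proof -
      have "real (Suc i) * k n - real i * k n = k n" by (simp add: algebra_simps)
      moreover have "0 \<le> real i * k n \<and> real i * k n < real (Suc i) * k n"
        using k[of n] by simp
      ultimately have "distributed M lborel (D n i) (normal_density 0 (sqrt (k n)))"
        using W unfolding wiener_process_def D_def[abs_def] by metis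
      from normal_density_affine[OF this, of "c n i" 0] k[of n] c[of n i] show ?thesis
        by simp
    qed
    ultimately have "distributed M lborel (\<lambda>\<omega>. \<Sum>i<Suc n. c n i * D n i \<omega>)
      (normal_density (\<Sum>i<Suc n. 0) (sqrt (\<Sum>i<Suc n. (c n i * sqrt (k n))\<^sup>2)))"
      using c k by (intro sum_indep_normal) (auto intro!: mult_pos_pos)
    then have "distr M lborel (S n) = normal_law 0 (sqrt (\<Sum>i<Suc n. (c n i * sqrt (k n))\<^sup>2))"
      by (simp add: distributed_def S_def[abs_def])
    then show ?thesis by (simp cong: distr_cong)
  qed
  have lawZ: "distr M borel Z = normal_law 0 (sqrt (\<tau>\<^sup>2 / (2 * \<alpha>) * (1 - exp (- 2 * \<alpha> * T))))"
  proof (rule normal_limit[OF VM[OF SV] VM[OF ZV] limZ normal])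
    show "0 < sqrt (\<Sum>i<Suc n. (c n i * sqrt (k n))\<^sup>2)" for n
      unfolding real_sqrt_gt_0_iff using order_less_imp_not_eq2[OF c] order_less_imp_not_eq2[OF k]
      by (intro sum_pos) auto
    show "(\<lambda>n. sqrt (\<Sum>i<Suc n. (c n i * sqrt (k n))\<^sup>2)) \<longlonglongrightarrow> sqrt (\<tau>\<^sup>2 / (2 * \<alpha>) * (1 - exp (- 2 * \<alpha> * T)))"
      unfolding c_def k_def by (intro tendsto_real_sqrt LIMSEQ_Suc[OF OU_variance_sum] \<alpha> \<tau> T)
    show "0 < sqrt (\<tau>\<^sup>2 / (2 * \<alpha>) * (1 - exp (- 2 * \<alpha> * T)))"
      using \<alpha> \<tau> T by simp
  qed
  have "indep_var borel (X 0) borel Z"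
    unfolding indep_var_eq
  proof (intro conjI X0 VM[OF ZV])
    \<comment> \<open>Independence of \<open>X 0\<close> from \<open>V\<close> passes to the smaller
      sigma-algebra generated by \<open>Z\<close>.\<close>
    have "sigma_sets (space M) {Z -` A \<inter> space M |A. A \<in> sets borel} \<subseteq> sets V"
      using measurable_sets[OF ZV] unfolding spV[symmetric] by (intro sets.sigma_sets_subset) auto
    then show "indep_set (sigma_sets (space M) {X 0 -` A \<inter> space M |A. A \<in> sets borel})
      (sigma_sets (space M) {Z -` A \<inter> space M |A. A \<in> sets borel})"
      using ind unfolding indep_sets2_eq sets_vimage_algebra[of "space M" "X 0"] V_def[symmetric] by blast
  qed
  moreover have "AE \<omega> in M. X T \<omega> = exp (- (\<alpha> * T)) * X 0 \<omega> + Z \<omega>"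
    using Z by eventually_elim simp
  ultimately show ?thesis using lawZ by blast
qed

section \<open>Stationary and transition laws\<close>

text \<open>The pair is a measurable image of the restriction to the index set
  \<open>{a, b}\<close>. The case a = b is included, and \<open>stationary_process_law\<close> reads
  the law of one coordinate off it.\<close>

lemma stationary_process_pair:
  assumes "stationary_process M X" "0 \<le> a" "0 \<le> b" "0 \<le> u"
  shows "distr M (borel \<Otimes>\<^sub>M borel) (\<lambda>\<omega>. (X (a + u) \<omega>, X (b + u) \<omega>)) =
    distr M (borel \<Otimes>\<^sub>M borel) (\<lambda>\<omega>. (X a \<omega>, X b \<omega>))"
proof -
  have meas [measurable]: "X t \<in> borel_measurable M" if "0 \<le> t" for t
    using assms(1) that by (simp add: stationary_process_def)
  let ?P = "\<Pi>\<^sub>M t\<in>{a, b}. (borel :: real measure)"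
  have *: "distr (distr M ?P (\<lambda>\<omega>. \<lambda>t\<in>{a, b}. X (t + v) \<omega>)) (borel \<Otimes>\<^sub>M borel) (\<lambda>f. (f a, f b)) =
    distr M (borel \<Otimes>\<^sub>M borel) (\<lambda>\<omega>. (X (a + v) \<omega>, X (b + v) \<omega>))" if "0 \<le> v" for v
  proof (subst distr_distr)
    show "(\<lambda>\<omega>. \<lambda>t\<in>{a, b}. X (t + v) \<omega>) \<in> M \<rightarrow>\<^sub>M ?P"
      using assms that by (intro measurable_restrict meas) auto
  qed (auto simp: comp_def)
  have "distr M ?P (\<lambda>\<omega>. \<lambda>t\<in>{a, b}. X (t + u) \<omega>) = distr M ?P (\<lambda>\<omega>. \<lambda>t\<in>{a, b}. X (t + 0) \<omega>)"
    using assms by (simp add: stationary_process_def)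
  then show ?thesis using *[of u] *[of 0] assms(4) by simp
qed

lemma stationary_process_law:
  assumes X: "stationary_process M X" and t: "0 \<le> t"
  shows "distr M borel (X t) = distr M borel (X 0)"
proof -
  have fst: "distr (distr M (borel \<Otimes>\<^sub>M borel) (\<lambda>\<omega>. (f \<omega>, f \<omega>))) borel fst = distr M borel f"
    if "f \<in> borel_measurable M" for f :: "'a \<Rightarrow> real"
    using that by (subst distr_distr) (auto simp: comp_def)
  have "X 0 \<in> borel_measurable M" "X t \<in> borel_measurable M"
    using X t by (auto simp: stationary_process_def)
  moreover have "distr M (borel \<Otimes>\<^sub>M borel) (\<lambda>\<omega>. (X t \<omega>, X t \<omega>)) =
      distr M (borel \<Otimes>\<^sub>M borel) (\<lambda>\<omega>. (X 0 \<omega>, X 0 \<omega>))"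
    using stationary_process_pair[OF X order_refl order_refl t] by (simp only: add_0)
  ultimately show ?thesis by (metis fst)
qed

text \<open>Stationarity and the innovation express \<open>\<phi> t\<close> as
  \<open>\<phi> (exp (- (\<alpha> * T)) * t)\<close> times a Gaussian factor, for every T > 0, while
  the left side does not depend on T. As T grows, continuity of \<open>\<phi>\<close> at 0 and
  \<open>\<phi> 0 = 1\<close> leave only the limit of the Gaussian factor.\<close>

lemma stationary_OU_law_0:
  assumes \<alpha>: "0 < \<alpha>" and \<tau>: "0 < \<tau>" and OU: "stationary_OU M \<alpha> \<tau> X"
  shows "distr M borel (X 0) = normal_law 0 (sqrt (\<tau>\<^sup>2 / (2 * \<alpha>)))"
proof (rule Levy_uniqueness)
  from OU interpret prob_space M by (simp add: stationary_OU_def)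
  have X: "stationary_process M X" using OU by (simp add: stationary_OU_def)
  then have X0 [measurable]: "X 0 \<in> borel_measurable M" and meas: "\<And>t. 0 \<le> t \<Longrightarrow> X t \<in> borel_measurable M"
    by (auto simp: stationary_process_def)
  define \<sigma> where "\<sigma> = sqrt (\<tau>\<^sup>2 / (2 * \<alpha>))"
  have \<sigma>: "0 < \<sigma>" using \<alpha> \<tau> by (simp add: \<sigma>_def)
  show R: "real_distribution (distr M borel (X 0))" by (rule real_distribution_distr) simp
  then interpret R: real_distribution "distr M borel (X 0)" .
  show "real_distribution (normal_law 0 (sqrt (\<tau>\<^sup>2 / (2 * \<alpha>))))"
    using \<sigma> by (intro real_distribution_normal_law) (simp add: \<sigma>_def)
  define \<phi> where "\<phi> = char (distr M borel (X 0))"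
  show "char (distr M borel (X 0)) = char (normal_law 0 (sqrt (\<tau>\<^sup>2 / (2 * \<alpha>))))"
  proof
    fix t
    define s where "s T = sqrt (\<tau>\<^sup>2 / (2 * \<alpha>) * (1 - exp (- 2 * \<alpha> * T)))" for T
    have step: "\<phi> t = \<phi> (exp (- (\<alpha> * T)) * t) * of_real (exp (- ((s T * t)\<^sup>2 / 2)))" if T: "0 < T" for T
    proof -
      obtain Z where ind: "indep_var borel (X 0) borel Z" and Z: "distr M borel Z = normal_law 0 (s T)"
        and XT: "AE \<omega> in M. X T \<omega> = exp (- (\<alpha> * T)) * X 0 \<omega> + Z \<omega>"
        using stationary_OU_innovation[OF \<alpha> \<tau> OU T] unfolding s_def by blast
      have [measurable]: "Z \<in> borel_measurable M" "X T \<in> borel_measurable M"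
        using indep_var_rv2[OF ind] T by (auto intro: meas)
      have sT: "0 < s T" using \<alpha> \<tau> T by (simp add: s_def)
      have "distr M borel (X 0) = distr M borel (X T)"
        using stationary_process_law[OF X, of T] T by simp
      also have "\<dots> = distr M borel (\<lambda>\<omega>. exp (- (\<alpha> * T)) * X 0 \<omega> + Z \<omega>)"
        by (rule distr_cong_AE[OF refl refl XT]) measurable
      finally have "\<phi> t = char (distr M borel (\<lambda>\<omega>. exp (- (\<alpha> * T)) * X 0 \<omega> + Z \<omega>)) t"
        by (simp add: \<phi>_def)
      also have "\<dots> = char (distr M borel (\<lambda>\<omega>. exp (- (\<alpha> * T)) * X 0 \<omega>)) t * char (distr M borel Z) t"
      proof (rule char_distr_add)
        have "indep_var borel ((\<lambda>x. exp (- (\<alpha> * T)) * x) \<circ> X 0) borel ((\<lambda>x. x) \<circ> Z)"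
          by (rule indep_var_compose[OF ind]) auto
        then show "indep_var borel (\<lambda>\<omega>. exp (- (\<alpha> * T)) * X 0 \<omega>) borel Z"
          by (simp only: comp_def)
      qed
      also have "char (distr M borel (\<lambda>\<omega>. exp (- (\<alpha> * T)) * X 0 \<omega>)) t = \<phi> (exp (- (\<alpha> * T)) * t)"
        unfolding \<phi>_def char_def by (subst (1 2) integral_distr) (auto simp: mult_ac)
      finally show ?thesis by (simp add: Z char_normal_law[OF sT])
    qed
    have "((\<lambda>T. exp (- (\<alpha> * T)) * t) \<longlongrightarrow> 0 * t) at_top"
      using \<alpha> by (intro tendsto_mult tendsto_const) real_asymp
    then have "((\<lambda>T. \<phi> (exp (- (\<alpha> * T)) * t)) \<longlongrightarrow> \<phi> 0) at_top"
      unfolding \<phi>_def by (intro isCont_tendsto_compose[OF R.isCont_char]) simp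
    moreover have "((\<lambda>T. 1 - exp (- 2 * \<alpha> * T)) \<longlongrightarrow> 1) at_top"
      using \<alpha> by real_asymp
    then have "(s \<longlongrightarrow> sqrt (\<tau>\<^sup>2 / (2 * \<alpha>) * 1)) at_top"
      unfolding s_def by (intro tendsto_real_sqrt tendsto_mult_left)
    then have "(s \<longlongrightarrow> \<sigma>) at_top" by (simp only: \<sigma>_def mult_1_right)
    then have "((\<lambda>T. complex_of_real (exp (- ((s T * t)\<^sup>2 / 2)))) \<longlongrightarrow> of_real (exp (- ((\<sigma> * t)\<^sup>2 / 2)))) at_top"
      by (intro tendsto_intros) auto
    ultimately have "((\<lambda>T. \<phi> (exp (- (\<alpha> * T)) * t) * of_real (exp (- ((s T * t)\<^sup>2 / 2))))
        \<longlongrightarrow> \<phi> 0 * of_real (exp (- ((\<sigma> * t)\<^sup>2 / 2)))) at_top"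
      by (rule tendsto_mult)
    moreover have "\<forall>\<^sub>F T in at_top. \<phi> (exp (- (\<alpha> * T)) * t) * of_real (exp (- ((s T * t)\<^sup>2 / 2))) = \<phi> t"
      using eventually_gt_at_top[of 0] by eventually_elim (rule step[symmetric])
    ultimately have "((\<lambda>T::real. \<phi> t) \<longlongrightarrow> \<phi> 0 * of_real (exp (- ((\<sigma> * t)\<^sup>2 / 2)))) at_top"
      by (rule Lim_transform_eventually)
    then have "\<phi> t = \<phi> 0 * of_real (exp (- ((\<sigma> * t)\<^sup>2 / 2)))"
      by (simp add: tendsto_const_iff)
    moreover have "\<phi> 0 = 1" unfolding \<phi>_def by (rule R.char_zero)
    ultimately show "char (distr M borel (X 0)) t = char (normal_law 0 (sqrt (\<tau>\<^sup>2 / (2 * \<alpha>)))) t"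
      unfolding \<phi>_def[symmetric] \<sigma>_def[symmetric] char_normal_law[OF \<sigma>] by simp
  qed
qed

lemma stationary_OU_law:
  assumes "0 < \<alpha>" "0 < \<tau>" "stationary_OU M \<alpha> \<tau> X" "0 \<le> t"
  shows "distr M borel (X t) = normal_law 0 (sqrt (\<tau>\<^sup>2 / (2 * \<alpha>)))"
  using stationary_process_law[of M X t] stationary_OU_law_0[of \<alpha> \<tau> M X] assms
  by (simp add: stationary_OU_def)

text \<open>Independence is a property of the joint law. By stationarity (X s, X t) has the law of
  (X 0, X (t - s)), and a linear map carries this over to the pairs formed with the innovations,
  where independence is known from time 0.\<close>

theorem stationary_OU_transition:
  assumes \<alpha>: "0 < \<alpha>" and \<tau>: "0 < \<tau>" and OU: "stationary_OU M \<alpha> \<tau> X" and st: "0 \<le> s" "s < t"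
  defines "Z \<equiv> \<lambda>\<omega>. X t \<omega> - exp (- (\<alpha> * (t - s))) * X s \<omega>"
  shows "prob_space.indep_var M borel (X s) borel Z"
    and "distr M borel Z = normal_law 0 (sqrt (\<tau>\<^sup>2 / (2 * \<alpha>) * (1 - exp (- 2 * \<alpha> * (t - s)))))"
proof -
  from OU interpret prob_space M by (simp add: stationary_OU_def)
  have X: "stationary_process M X" using OU by (simp add: stationary_OU_def)
  then have meas: "\<And>t. 0 \<le> t \<Longrightarrow> X t \<in> borel_measurable M"
    by (auto simp: stationary_process_def)
  define u where "u = t - s"
  have u: "0 < u" using st by (simp add: u_def)
  obtain Z0 where ind: "indep_var borel (X 0) borel Z0"
    and Z0: "distr M borel Z0 = normal_law 0 (sqrt (\<tau>\<^sup>2 / (2 * \<alpha>) * (1 - exp (- 2 * \<alpha> * u))))"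
    and Xu: "AE \<omega> in M. X u \<omega> = exp (- (\<alpha> * u)) * X 0 \<omega> + Z0 \<omega>"
    using stationary_OU_innovation[OF \<alpha> \<tau> OU u] by blast
  have [measurable]: "Z0 \<in> borel_measurable M" "X 0 \<in> borel_measurable M" "X u \<in> borel_measurable M"
    "X s \<in> borel_measurable M" "X t \<in> borel_measurable M"
    using indep_var_rv2[OF ind] u st by (auto intro: meas)
  have [measurable]: "Z \<in> borel_measurable M" unfolding Z_def by measurable
  let ?e = "exp (- (\<alpha> * u))"
  have Zu: "Z = (\<lambda>\<omega>. X t \<omega> - ?e * X s \<omega>)" by (simp add: Z_def u_def)
  have "distr M (borel \<Otimes>\<^sub>M borel) (\<lambda>\<omega>. (X s \<omega>, X t \<omega>)) = distr M (borel \<Otimes>\<^sub>M borel) (\<lambda>\<omega>. (X 0 \<omega>, X u \<omega>))"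
    using stationary_process_pair[OF X order_refl less_imp_le[OF u] st(1)] by (simp add: u_def)
  from arg_cong[OF this, of "\<lambda>P. distr P (borel \<Otimes>\<^sub>M borel) (\<lambda>(x, y). (x, y - ?e * x))"]
  have "distr M (borel \<Otimes>\<^sub>M borel) (\<lambda>\<omega>. (X s \<omega>, Z \<omega>)) = distr M (borel \<Otimes>\<^sub>M borel) (\<lambda>\<omega>. (X 0 \<omega>, X u \<omega> - ?e * X 0 \<omega>))"
    by (simp add: distr_distr comp_def Zu)
  also have "\<dots> = distr M (borel \<Otimes>\<^sub>M borel) (\<lambda>\<omega>. (X 0 \<omega>, Z0 \<omega>))"
    using Xu by (intro distr_cong_AE) auto
  finally have joint: "distr M (borel \<Otimes>\<^sub>M borel) (\<lambda>\<omega>. (X s \<omega>, Z \<omega>)) = distr M (borel \<Otimes>\<^sub>M borel) (\<lambda>\<omega>. (X 0 \<omega>, Z0 \<omega>))" .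
  from arg_cong[OF joint, of "\<lambda>P. distr P borel snd"]
  have lawZ: "distr M borel Z = distr M borel Z0" by (simp add: distr_distr comp_def)
  then show "distr M borel Z = normal_law 0 (sqrt (\<tau>\<^sup>2 / (2 * \<alpha>) * (1 - exp (- 2 * \<alpha> * (t - s)))))"
    by (simp only: Z0 u_def)
  show "indep_var borel (X s) borel Z"
    using ind unfolding indep_var_distribution_eq
    by (simp add: lawZ joint stationary_process_law[OF X st(1)])
qed

text \<open>With \<open>\<rho>\<close> the correlation, X t + X s is
  \<open>(1 + \<rho>) * X s\<close> plus an independent innovation, of total variance
  \<open>2 * (1 + \<rho>) * v\<close>. It is below \<open>4 * v\<close> because
  \<open>\<rho> < 1\<close>; this strictness makes joint exceedances rare.\<close>

lemma stationary_OU_sum_law: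
  assumes \<alpha>: "0 < \<alpha>" and \<tau>: "0 < \<tau>" and OU: "stationary_OU M \<alpha> \<tau> X" and st: "0 \<le> s" "s < t"
  shows "\<exists>w. 0 < w \<and> w < 2 * sqrt (\<tau>\<^sup>2 / (2 * \<alpha>)) \<and> distr M borel (\<lambda>\<omega>. X t \<omega> + X s \<omega>) = normal_law 0 w"
proof -
  from OU interpret prob_space M by (simp add: stationary_OU_def)
  define v where "v = \<tau>\<^sup>2 / (2 * \<alpha>)"
  define \<rho> where "\<rho> = exp (- (\<alpha> * (t - s)))"
  define Z where "Z \<omega> = X t \<omega> - \<rho> * X s \<omega>" for \<omega>
  define w where "w = sqrt (((1 + \<rho>) * sqrt v)\<^sup>2 + (sqrt (v * (1 - \<rho>\<^sup>2)))\<^sup>2)"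
  have v: "0 < v" using \<alpha> \<tau> by (simp add: v_def)
  have \<rho>: "0 < \<rho>" "\<rho> < 1" using \<alpha> st by (simp_all add: \<rho>_def)
  have \<rho>2: "\<rho>\<^sup>2 < 1" using \<rho> by (simp add: power_less_one_iff)
  have exp: "exp (- 2 * \<alpha> * (t - s)) = \<rho>\<^sup>2"
    unfolding \<rho>_def exp_of_nat_mult[symmetric] by (simp add: algebra_simps)
  have ind: "indep_var borel (X s) borel Z"
    using stationary_OU_transition(1)[OF \<alpha> \<tau> OU st] unfolding Z_def[abs_def] \<rho>_def .
  have lawZ: "distr M borel Z = normal_law 0 (sqrt (v * (1 - \<rho>\<^sup>2)))"
    using stationary_OU_transition(2)[OF \<alpha> \<tau> OU st] unfolding Z_def[abs_def] \<rho>_def[symmetric] v_def[symmetric] exp .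
  have law: "distr M borel (X s) = normal_law 0 (sqrt v)"
    using stationary_OU_law[OF \<alpha> \<tau> OU st(1)] unfolding v_def .
  have rv: "X s \<in> borel_measurable M" "Z \<in> borel_measurable M"
    using indep_var_rv1[OF ind] indep_var_rv2[OF ind] .
  have dX: "distributed M lborel (X s) (normal_density 0 (sqrt v))"
    and dZ: "distributed M lborel Z (normal_density 0 (sqrt (v * (1 - \<rho>\<^sup>2))))"
    using law lawZ rv by (simp_all add: distributed_def cong: distr_cong)
  have "distributed M lborel (\<lambda>\<omega>. (1 + \<rho>) * X s \<omega>) (normal_density 0 ((1 + \<rho>) * sqrt v))"
    using normal_density_affine[OF dX, of "1 + \<rho>" 0] v \<rho> by simp
  moreover have "indep_var borel (\<lambda>\<omega>. (1 + \<rho>) * X s \<omega>) borel Z"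
  proof -
    have "indep_var borel ((\<lambda>x. (1 + \<rho>) * x) \<circ> X s) borel ((\<lambda>x. x) \<circ> Z)"
      by (rule indep_var_compose[OF ind]) auto
    then show ?thesis by (simp only: comp_def)
  qed
  ultimately have "distributed M lborel (\<lambda>\<omega>. (1 + \<rho>) * X s \<omega> + Z \<omega>) (normal_density (0 + 0) w)"
    unfolding w_def using v \<rho> \<rho>2 by (intro add_indep_normal dZ) auto
  moreover have "(\<lambda>\<omega>. (1 + \<rho>) * X s \<omega> + Z \<omega>) = (\<lambda>\<omega>. X t \<omega> + X s \<omega>)"
    by (auto simp: Z_def algebra_simps)
  ultimately have "distr M borel (\<lambda>\<omega>. X t \<omega> + X s \<omega>) = normal_law 0 w"
    by (simp add: distributed_def cong: distr_cong)
  moreover have w2: "((1 + \<rho>) * sqrt v)\<^sup>2 + (sqrt (v * (1 - \<rho>\<^sup>2)))\<^sup>2 = 2 * (1 + \<rho>) * v"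
    using v \<rho>2 by (simp add: power_mult_distrib) (simp add: power2_eq_square algebra_simps)
  then have "0 < w" using v \<rho> by (simp add: w_def)
  moreover have "2 * (1 + \<rho>) * v < 4 * v" using v \<rho> by simp
  then have "w < sqrt (4 * v)"
    unfolding w_def w2 by (rule real_sqrt_less_mono)
  then have "w < 2 * sqrt v" by (simp add: real_sqrt_mult)
  ultimately show ?thesis unfolding v_def[symmetric] by blast
qed

section \<open>Tails of increments\<close>

text \<open>Separates the two limits: the bounds converge along G for each fixed e, and their limits
  meet only as e tends to 0.\<close>

lemma tendsto_squeeze_family:
  fixes g :: "'b \<Rightarrow> real"
  assumes bounds: "\<And>e. 0 < e \<Longrightarrow> e < 1 \<Longrightarrow> \<exists>lo hi. (\<forall>\<^sub>F y in G. lo y \<le> g y) \<and> (\<forall>\<^sub>F y in G. g y \<le> hi y) \<and>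
      (lo \<longlongrightarrow> l e) G \<and> (hi \<longlongrightarrow> u e) G"
    and l: "(l \<longlongrightarrow> c) (at_right (0::real))" and u: "(u \<longlongrightarrow> c) (at_right 0)"
  shows "(g \<longlongrightarrow> c) G"
proof (rule order_tendstoI)
  have ev01: "\<forall>\<^sub>F e in at_right (0::real). 0 < e \<and> e < 1"
    using eventually_at_right_less[of 0] eventually_at_right_real[of 0 1] by (auto elim: eventually_mono)
  fix a assume "a < c"
  then have "\<forall>\<^sub>F e in at_right 0. (0 < e \<and> e < 1) \<and> a < l e"
    by (intro eventually_conj ev01 order_tendstoD(1)[OF l])
  then obtain e where "0 < e" "e < 1" "a < l e"
    using eventually_happens[of _ "at_right (0::real)"] by auto
  with bounds obtain lo where "\<forall>\<^sub>F y in G. lo y \<le> g y" "(lo \<longlongrightarrow> l e) G" by blast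
  from this(1) order_tendstoD(1)[OF this(2) \<open>a < l e\<close>]
  show "\<forall>\<^sub>F y in G. a < g y" by eventually_elim simp
next
  have ev01: "\<forall>\<^sub>F e in at_right (0::real). 0 < e \<and> e < 1"
    using eventually_at_right_less[of 0] eventually_at_right_real[of 0 1] by (auto elim: eventually_mono)
  fix a assume "c < a"
  then have "\<forall>\<^sub>F e in at_right 0. (0 < e \<and> e < 1) \<and> u e < a"
    by (intro eventually_conj ev01 order_tendstoD(2)[OF u])
  then obtain e where "0 < e" "e < 1" "u e < a"
    using eventually_happens[of _ "at_right (0::real)"] by auto
  with bounds obtain hi where "\<forall>\<^sub>F y in G. g y \<le> hi y" "(hi \<longlongrightarrow> u e) G" by blast
  from this(1) order_tendstoD(2)[OF this(2) \<open>u e < a\<close>]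
  show "\<forall>\<^sub>F y in G. g y < a" by eventually_elim simp
qed

text \<open>The centred normal law is symmetric, so x may be replaced by -x; then a large value of
  \<open>- h (- x)\<close> forces a much larger value of \<open>h x\<close>.\<close>

lemma normal_law_small_left_tail:
  fixes h :: "real \<Rightarrow> real"
  assumes h: "strict_mono h" "continuous_on UNIV h" and lim: "filterlim h at_top at_top"
    and small: "(\<lambda>x. h (- x)) \<in> o[at_top](h)" and \<sigma>: "0 < \<sigma>" and e: "0 < e"
  shows "\<forall>\<^sub>F y in at_top. measure (normal_law 0 \<sigma>) {x. - h x > e * y} \<le> measure (normal_law 0 \<sigma>) {x. h x > 1 / e * y}"
proof -
  interpret real_distribution "normal_law 0 \<sigma>" by (rule real_distribution_normal_law[OF \<sigma>])
  have [measurable]: "h \<in> borel_measurable borel"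
    by (rule borel_measurable_continuous_onI[OF h(2)])
  \<comment> \<open>The square makes \<open>- h (- x) > e * y\<close> imply
    \<open>h x > y / e\<close>, a level far above y. With e in its place the level would be y
    itself, and the tail there is not negligible.\<close>
  have "\<forall>\<^sub>F x in at_top. \<bar>h (- x)\<bar> \<le> e\<^sup>2 * \<bar>h x\<bar> \<and> 0 < h x"
    using landau_o.smallD[OF small, of "e\<^sup>2"] e lim
    by (auto intro!: eventually_conj simp: filterlim_at_top_dense)
  then obtain x0 where x0: "\<And>x. x0 \<le> x \<Longrightarrow> \<bar>h (- x)\<bar> \<le> e\<^sup>2 * h x"
    unfolding eventually_at_top_linorder by force
  \<comment> \<open>From this y on, the event forces \<open>h (- x) < h (- x0)\<close>, hence x lies
    in the region where the bound on \<open>h (- x)\<close> holds.\<close>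
  show ?thesis
    using eventually_ge_at_top[of "- h (- x0) / e"]
  proof eventually_elim
    case (elim y)
    have [measurable]: "{x. - h x > e * y} \<in> sets borel" "{x. h x > 1 / e * y} \<in> sets borel" by measurable
    have "measure (normal_law 0 \<sigma>) {x. - h x > e * y} = measure (distr (normal_law 0 \<sigma>) lborel uminus) {x. - h x > e * y}"
      by (simp add: distr_uminus_normal_law[OF \<sigma>])
    also have "\<dots> = measure (normal_law 0 \<sigma>) {x. - h (- x) > e * y}"
      by (subst measure_distr) (auto intro!: arg_cong[where f="measure _"])
    also have "\<dots> \<le> measure (normal_law 0 \<sigma>) {x. h x > 1 / e * y}"
    proof (intro finite_measure_mono subsetI)
      fix x assume "x \<in> {x. - h (- x) > e * y}"
      then have x: "e * y < - h (- x)" by simp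
      have "- h (- x0) \<le> e * y" using mult_left_mono[OF elim, of e] e by simp
      then have "h (- x) < h (- x0)" using x by simp
      then have "x0 \<le> x" using strict_mono_less[OF h(1)] by auto
      from x0[OF this] x have "e * y < e * (e * h x)" by (simp add: power2_eq_square mult.assoc)
      then have "y < e * h x" using e by simp
      then show "x \<in> {x. h x > 1 / e * y}" using e by (simp add: divide_less_eq mult.commute)
    qed simp
    finally show ?case .
  qed
qed

text \<open>If \<open>U\<close> and \<open>V\<close> are not perfectly correlated, then \<open>U + V\<close> has standard deviation \<open>w < 2 \<sigma>\<close>, so
  that its exceeding \<open>2 (x - 1)\<close> is negligible compared to \<open>U\<close> exceeding \<open>x\<close>; this rules out that
  \<open>h U\<close> and \<open>h V\<close> are both of order \<open>y = h x\<close>.\<close>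

theorem (in prob_space) increment_tail_asymp_equiv:
  fixes h :: "real \<Rightarrow> real"
  assumes h: "strict_mono h" "continuous_on UNIV h" and A: "cond_A_plus h b"
    and small: "(\<lambda>x. h (- x)) \<in> o[at_top](h)"
    and U[measurable]: "U \<in> borel_measurable M" and V[measurable]: "V \<in> borel_measurable M"
    and lawU: "distr M borel U = normal_law 0 \<sigma>" and lawV: "distr M borel V = normal_law 0 \<sigma>"
    and lawUV: "distr M borel (\<lambda>\<omega>. U \<omega> + V \<omega>) = normal_law 0 w"
    and \<sigma>: "0 < \<sigma>" and w: "0 < w" "w < 2 * \<sigma>"
  shows "(\<lambda>y. prob {\<omega> \<in> space M. h (U \<omega>) - h (V \<omega>) > y}) \<sim>[at_top] (\<lambda>y. prob {\<omega> \<in> space M. h (U \<omega>) > y})"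
proof (rule asymp_equivI')
  note lim = cond_A_plus_at_top[OF A]
  have [measurable]: "h \<in> borel_measurable borel"
    by (rule borel_measurable_continuous_onI[OF h(2)])
  define T where "T y = measure (normal_law 0 \<sigma>) {x. h x > y}" for y
  define P where "P y = prob {\<omega> \<in> space M. h (U \<omega>) - h (V \<omega>) > y}" for y
  have TU: "prob {\<omega> \<in> space M. h (U \<omega>) > y} = T y" for y
    unfolding T_def lawU[symmetric] by (subst measure_distr) (auto intro!: arg_cong[where f=prob])
  define J where "J y = normal_tail 0 w (2 * (inv h y - 1))" for y
  have Tpos: "\<forall>\<^sub>F y in at_top. 0 < T y"
    unfolding T_def by (rule normal_law_tail_pos[OF h lim \<sigma>])
  have Tratio: "((\<lambda>y. T (c * y) / T y) \<longlongrightarrow> c powr (- (1 / (2 * b * \<sigma>\<^sup>2)))) at_top" if "0 < c" for c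
    unfolding T_def by (rule normal_law_tail_ratio[OF h A that \<sigma>])
  have "((\<lambda>y. J y / normal_tail 0 \<sigma> (inv h y)) \<longlongrightarrow> 0) at_top"
    unfolding J_def by (rule filterlim_compose[OF normal_tail_ratio_0[OF \<sigma> w] inv_at_top[OF h lim]])
  moreover have "\<forall>\<^sub>F y in at_top. J y / normal_tail 0 \<sigma> (inv h y) = J y / T y"
    using normal_law_tail_eq[OF h lim, of 0 \<sigma>] by eventually_elim (simp add: T_def)
  ultimately have J0: "((\<lambda>y. J y / T y) \<longlongrightarrow> 0) at_top"
    by (rule Lim_transform_eventually)
  define \<beta> where "\<beta> = 1 / (2 * b * \<sigma>\<^sup>2)"
  have b: "0 < b" using A by (simp add: cond_A_plus_def)
  have \<beta>: "0 < \<beta>" using b \<sigma> by (simp add: \<beta>_def)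
  have "((\<lambda>y. P y / T y) \<longlongrightarrow> 1) at_top"
  proof (rule tendsto_squeeze_family)
    fix e :: real assume e: "0 < e" "e < 1"
    \<comment> \<open>Lower bound: if \<open>h U > (1 + e) * y\<close>, then the increment exceeds y
      unless \<open>h V > e * y\<close>, and that joint event is dominated by \<open>J\<close>.
      Upper bound: an increment above y needs \<open>h U > (1 - e) * y\<close> or
      \<open>- h V > e * y\<close>.\<close>
    let ?lo = "\<lambda>y. T ((1 + e) * y) / T y - J y / T y"
    let ?hi = "\<lambda>y. T ((1 - e) * y) / T y + T (1 / e * y) / T y"
    show "\<exists>lo hi. (\<forall>\<^sub>F y in at_top. lo y \<le> P y / T y) \<and> (\<forall>\<^sub>F y in at_top. P y / T y \<le> hi y) \<and>
      (lo \<longlongrightarrow> (1 + e) powr (- \<beta>) - 0) at_top \<and> (hi \<longlongrightarrow> (1 - e) powr (- \<beta>) + (1 / e) powr (- \<beta>)) at_top"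
    proof (intro exI conjI)
      show "(?lo \<longlongrightarrow> (1 + e) powr (- \<beta>) - 0) at_top"
        unfolding \<beta>_def using e by (intro tendsto_diff Tratio J0) simp
      show "(?hi \<longlongrightarrow> (1 - e) powr (- \<beta>) + (1 / e) powr (- \<beta>)) at_top"
        unfolding \<beta>_def using e by (intro tendsto_add Tratio) simp_all
      have left: "\<forall>\<^sub>F y in at_top. prob {\<omega> \<in> space M. - h (V \<omega>) > e * y} \<le> T (1 / e * y)"
        using normal_law_small_left_tail[OF h lim small \<sigma> e(1)]
      proof eventually_elim
        case (elim y)
        have "prob {\<omega> \<in> space M. - h (V \<omega>) > e * y} = measure (normal_law 0 \<sigma>) {x. - h x > e * y}"
          unfolding lawV[symmetric] by (subst measure_distr) (auto intro!: arg_cong[where f=prob])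
        then show ?case using elim by (simp add: T_def)
      qed
      show "\<forall>\<^sub>F y in at_top. P y / T y \<le> ?hi y"
        using left Tpos
      proof eventually_elim
        case (elim y)
        have "P y \<le> prob ({\<omega> \<in> space M. h (U \<omega>) > (1 - e) * y} \<union> {\<omega> \<in> space M. - h (V \<omega>) > e * y})"
          unfolding P_def by (intro finite_measure_mono) (auto simp: algebra_simps)
        also have "\<dots> \<le> prob {\<omega> \<in> space M. h (U \<omega>) > (1 - e) * y} + prob {\<omega> \<in> space M. - h (V \<omega>) > e * y}"
          by (intro measure_Un_le) auto
        also have "\<dots> \<le> T ((1 - e) * y) + T (1 / e * y)"
          using elim(1) by (simp add: TU)
        finally show ?case
          using elim(2) by (simp add: add_divide_distrib[symmetric] divide_right_mono)
      qed
      \<comment> \<open>A constant factor in the level moves the preimage only by o(1). So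
        \<open>h V > e * y\<close> already means \<open>V > inv h y - 1\<close>, which explains the
        threshold \<open>2 * (inv h y - 1)\<close> in \<open>J\<close>.\<close>
      have near: "((\<lambda>y. inv h (e * y) - inv h y) \<longlongrightarrow> 0) at_top"
        by (rule normal_tail_ratio(2)[OF \<sigma> _ inv_at_top[OF h lim] inv_square_diff[OF h A e(1)]])
           (rule filterlim_compose[OF inv_at_top[OF h lim] filterlim_cmult_at_top[OF e(1)]])
      note range = eventually_in_range[OF h(2) lim]
      show "\<forall>\<^sub>F y in at_top. ?lo y \<le> P y / T y"
        using Tpos order_tendstoD(1)[OF near, of "-1", simplified] range
          eventually_compose_filterlim[OF range filterlim_cmult_at_top[OF e(1)]] eventually_gt_at_top[of 0]
      proof eventually_elim
        case (elim y)
        have "prob {\<omega> \<in> space M. h (U \<omega>) > (1 + e) * y} \<le>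
          prob ({\<omega> \<in> space M. h (U \<omega>) - h (V \<omega>) > y} \<union> {\<omega> \<in> space M. U \<omega> + V \<omega> > 2 * (inv h y - 1)})"
        proof (intro finite_measure_mono subsetI)
          fix \<omega> assume "\<omega> \<in> {\<omega> \<in> space M. h (U \<omega>) > (1 + e) * y}"
          then have \<omega>: "\<omega> \<in> space M" "h (U \<omega>) > y + e * y" by (auto simp: algebra_simps)
          show "\<omega> \<in> {\<omega> \<in> space M. h (U \<omega>) - h (V \<omega>) > y} \<union> {\<omega> \<in> space M. U \<omega> + V \<omega> > 2 * (inv h y - 1)}"
          proof (cases "h (V \<omega>) > e * y")
            case True
            then have "h (V \<omega>) > h (inv h (e * y))" using elim by simp
            then have "V \<omega> > inv h (e * y)" using strict_mono_less[OF h(1)] by blast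
            moreover have "h (U \<omega>) > h (inv h y)"
              using \<omega>(2) elim mult_pos_pos[OF e(1), of y] by simp
            then have "U \<omega> > inv h y" using strict_mono_less[OF h(1)] by blast
            ultimately have "U \<omega> + V \<omega> > 2 * (inv h y - 1)" using elim by simp
            then show ?thesis using \<omega> by simp
          qed (use \<omega> in auto)
        qed measurable
        also have "\<dots> \<le> P y + prob {\<omega> \<in> space M. U \<omega> + V \<omega> > 2 * (inv h y - 1)}"
          unfolding P_def by (intro measure_Un_le) auto
        also have "prob {\<omega> \<in> space M. U \<omega> + V \<omega> > 2 * (inv h y - 1)} = J y"
          unfolding J_def normal_tail_def lawUV[symmetric]
          by (subst measure_distr) (auto intro!: arg_cong[where f=prob])
        finally have "T ((1 + e) * y) - J y \<le> P y" by (simp add: TU)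
        then show ?case
          using elim(1) by (simp add: diff_divide_distrib[symmetric] divide_right_mono)
      qed
    qed
  next
    show "((\<lambda>e. (1 + e) powr (- \<beta>) - 0) \<longlongrightarrow> 1) (at_right 0)" by real_asymp
    have "((\<lambda>e. (1 - e) powr (- \<beta>)) \<longlongrightarrow> 1) (at_right 0)" by real_asymp
    moreover have "((\<lambda>e. (1 / e) powr (- \<beta>)) \<longlongrightarrow> 0) (at_right 0)" using \<beta> by real_asymp
    ultimately show "((\<lambda>e. (1 - e) powr (- \<beta>) + (1 / e) powr (- \<beta>)) \<longlongrightarrow> 1) (at_right 0)"
      using tendsto_add[of _ 1 _ _ 0] by fastforce
  qed
  then show "((\<lambda>y. prob {\<omega> \<in> space M. h (U \<omega>) - h (V \<omega>) > y} / prob {\<omega> \<in> space M. h (U \<omega>) > y}) \<longlongrightarrow> 1) at_top"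
    by (simp add: P_def TU)
qed

section \<open>Transition kernels\<close>

lemma real_distribution_kernel:
  assumes "K \<in> borel \<rightarrow>\<^sub>M prob_algebra (borel :: real measure)"
  shows "real_distribution (K z)"
proof -
  have "K z \<in> space (prob_algebra borel)"
    using measurable_space[OF assms] by simp
  then show ?thesis
    by (auto simp: space_prob_algebra real_distribution_def real_distribution_axioms_def)
qed

text \<open>Testing with the set where g < f makes the difference of the integrands nonnegative with
  integral 0, hence almost surely 0.\<close>

lemma (in prob_space) AE_le_of_set_integral_eq:
  fixes f g :: "real \<Rightarrow> real"
  assumes Z[measurable]: "Z \<in> borel_measurable M"
    and f[measurable]: "f \<in> borel_measurable borel" and g[measurable]: "g \<in> borel_measurable borel"
    and bounds: "\<And>z. \<bar>f z\<bar> \<le> 1" "\<And>z. \<bar>g z\<bar> \<le> 1"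
    and eq: "\<And>A. A \<in> sets borel \<Longrightarrow>
      (\<integral>\<omega>. indicator A (Z \<omega>) * f (Z \<omega>) \<partial>M) = (\<integral>\<omega>. indicator A (Z \<omega>) * g (Z \<omega>) \<partial>M)"
  shows "AE \<omega> in M. f (Z \<omega>) \<le> g (Z \<omega>)"
proof -
  define A where "A = {z. g z < f z}"
  have A[measurable]: "A \<in> sets borel" unfolding A_def by measurable
  have int: "integrable M (\<lambda>\<omega>. indicator A (Z \<omega>) * f (Z \<omega>))" "integrable M (\<lambda>\<omega>. indicator A (Z \<omega>) * g (Z \<omega>))"
    using bounds by (auto intro!: integrable_const_bound[where B = 1] simp: indicator_def)
  have "(\<integral>\<omega>. indicator A (Z \<omega>) * f (Z \<omega>) - indicator A (Z \<omega>) * g (Z \<omega>) \<partial>M) = 0"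
    using eq[OF A] by (simp add: Bochner_Integration.integral_diff[OF int])
  moreover have "AE \<omega> in M. 0 \<le> indicator A (Z \<omega>) * f (Z \<omega>) - indicator A (Z \<omega>) * g (Z \<omega>)"
    by (auto simp: indicator_def A_def)
  ultimately have "AE \<omega> in M. indicator A (Z \<omega>) * f (Z \<omega>) - indicator A (Z \<omega>) * g (Z \<omega>) = 0"
    using integral_nonneg_eq_0_iff_AE[OF Bochner_Integration.integrable_diff[OF int]] by simp
  then show ?thesis
    by eventually_elim (auto simp: indicator_def A_def split: if_splits)
qed

text \<open>Distribution functions are right continuous. The rational restriction lets the
  exceptional null sets in \<open>cond_distribution_unique\<close> be united countably.\<close>

lemma real_distribution_eq_rat:
  assumes "real_distribution P" "real_distribution Q"
    and eq: "\<And>q. q \<in> \<rat> \<Longrightarrow> measure P {..q} = measure Q {..q}"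
  shows "P = Q"
proof (rule cdf_unique[OF assms(1,2)], rule ext)
  have le: "cdf P a \<le> cdf Q a"
    if "real_distribution P" "real_distribution Q" and eq: "\<And>q. q \<in> \<rat> \<Longrightarrow> cdf P q = cdf Q q" for P Q and a
  proof (rule ccontr)
    interpret P: real_distribution P by fact
    interpret Q: real_distribution Q by fact
    assume "\<not> cdf P a \<le> cdf Q a"
    moreover have "(cdf Q \<longlongrightarrow> cdf Q a) (at_right a)"
      using Q.cdf_is_right_cont[of a] by (simp add: continuous_within)
    ultimately have "\<forall>\<^sub>F x in at_right a. cdf Q x < cdf P a"
      by (intro order_tendstoD) auto
    then obtain c where c: "a < c" "\<And>x. a < x \<Longrightarrow> x < c \<Longrightarrow> cdf Q x < cdf P a"
      unfolding eventually_at_right[OF less_add_one] by auto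
    obtain q where q: "q \<in> \<rat>" "a < q" "q < c" using Rats_dense_in_real[OF c(1)] by auto
    have "cdf P a \<le> cdf P q" using q by (intro P.cdf_nondecreasing) simp
    also have "\<dots> = cdf Q q" using q by (intro eq)
    also have "\<dots> < cdf P a" using q by (intro c)
    finally show False by simp
  qed
  show "cdf P a = cdf Q a" for a
    using assms le[of P Q a] le[of Q P a] by (auto simp: cdf_def)
qed

text \<open>The set \<open>D\<close> where the kernels agree is Borel and has full measure, being a
  countable intersection over rational levels. Each z in \<open>R\<close> is a limit of points of
  \<open>R \<inter> D\<close>; along them the kernels coincide, so both values at z are the same
  weak limit.\<close>

lemma cond_distribution_unique:
  assumes "prob_space M" and Z: "Z \<in> borel_measurable M"
    and K: "cond_distribution M Z V R K" and K': "cond_distribution M Z V R K'"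
    and support: "\<And>D z. D \<in> sets borel \<Longrightarrow> AE \<omega> in M. Z \<omega> \<in> D \<Longrightarrow> z \<in> R \<Longrightarrow>
      \<exists>zs. (\<forall>n. zs n \<in> R \<inter> D) \<and> zs \<longlonglongrightarrow> z"
    and z: "z \<in> R"
  shows "K z = K' z"
proof -
  interpret prob_space M by fact
  have meas: "K \<in> borel \<rightarrow>\<^sub>M prob_algebra borel" "K' \<in> borel \<rightarrow>\<^sub>M prob_algebra borel"
    using K K' by (simp_all add: cond_distribution_def)
  note rd = meas[THEN real_distribution_kernel]
  have mK[measurable]: "(\<lambda>z. measure (K z) {..q}) \<in> borel_measurable borel"
      "(\<lambda>z. measure (K' z) {..q}) \<in> borel_measurable borel" for q
    by (rule measurable_compose[OF meas(1) measurable_measure_prob_algebra], simp)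
       (rule measurable_compose[OF meas(2) measurable_measure_prob_algebra], simp)
  have bound: "\<bar>measure (K z) {..q}\<bar> \<le> 1" "\<bar>measure (K' z) {..q}\<bar> \<le> 1" for z q
    using rd[of z] by (simp_all add: real_distribution_def prob_space.prob_le_1)
  have eq: "(\<integral>\<omega>. indicator A (Z \<omega>) * measure (K (Z \<omega>)) {..q} \<partial>M) =
      (\<integral>\<omega>. indicator A (Z \<omega>) * measure (K' (Z \<omega>)) {..q} \<partial>M)" if "A \<in> sets borel" for A q
  proof -
    have "prob {\<omega> \<in> space M. Z \<omega> \<in> A \<and> V \<omega> \<in> {..q}} = (\<integral>\<omega>. indicator A (Z \<omega>) * measure (K (Z \<omega>)) {..q} \<partial>M)"
      using K that unfolding cond_distribution_def by (meson atMost_borel)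
    moreover have "prob {\<omega> \<in> space M. Z \<omega> \<in> A \<and> V \<omega> \<in> {..q}} = (\<integral>\<omega>. indicator A (Z \<omega>) * measure (K' (Z \<omega>)) {..q} \<partial>M)"
      using K' that unfolding cond_distribution_def by (meson atMost_borel)
    ultimately show ?thesis by simp
  qed
  define D where "D = (\<Inter>q\<in>\<rat>. {z. measure (K z) {..q} = measure (K' z) {..q}})"
  have D: "D \<in> sets borel"
    unfolding D_def
  proof (rule sets.countable_INT'')
    show "{z. measure (K z) {..q} = measure (K' z) {..q}} \<in> sets borel" for q by measurable
  qed (auto simp: countable_rat)
  have "AE \<omega> in M. \<forall>q\<in>\<rat>. measure (K (Z \<omega>)) {..q} = measure (K' (Z \<omega>)) {..q}"
  proof (rule AE_ball_countable[THEN iffD2], simp add: countable_rat, intro ballI)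
    fix q
    have "AE \<omega> in M. measure (K (Z \<omega>)) {..q} \<le> measure (K' (Z \<omega>)) {..q}"
      by (rule AE_le_of_set_integral_eq[OF Z mK bound eq])
    moreover have "AE \<omega> in M. measure (K' (Z \<omega>)) {..q} \<le> measure (K (Z \<omega>)) {..q}"
      by (rule AE_le_of_set_integral_eq[OF Z mK(2,1) bound(2,1) eq[symmetric]])
    ultimately show "AE \<omega> in M. measure (K (Z \<omega>)) {..q} = measure (K' (Z \<omega>)) {..q}"
      by eventually_elim simp
  qed
  then have "AE \<omega> in M. Z \<omega> \<in> D" by (simp add: D_def)
  from support[OF D this z] obtain zs where zs: "\<And>n. zs n \<in> R" "\<And>n. zs n \<in> D" "zs \<longlonglongrightarrow> z" by blast
  have same: "K (zs n) = K' (zs n)" for n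
    using zs(2)[of n] by (intro real_distribution_eq_rat rd) (simp add: D_def)
  have "weak_conv_m (\<lambda>n. K (zs n)) (K z)" "weak_conv_m (\<lambda>n. K' (zs n)) (K' z)"
    using K K' zs z unfolding cond_distribution_def by blast+
  then have "(\<lambda>n. char (K (zs n)) t) \<longlonglongrightarrow> char (K z) t" "(\<lambda>n. char (K (zs n)) t) \<longlonglongrightarrow> char (K' z) t" for t
    unfolding same by (auto intro!: levy_continuity1 rd)
  then have "char (K z) = char (K' z)" using LIMSEQ_unique by blast
  then show ?thesis by (intro Levy_uniqueness rd)
qed

text \<open>The normal density is positive, so \<open>D\<close> has full Lebesgue measure and meets
  every interval \<open>{x <..< x + 1 / real (Suc n)}\<close>.\<close>

lemma normal_law_support:
  assumes "0 < \<sigma>" and "AE x in normal_law \<mu> \<sigma>. x \<in> D"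
  shows "\<exists>xs. (\<forall>n. xs n \<in> D) \<and> xs \<longlonglongrightarrow> (x :: real)"
proof -
  have AE: "AE x in lborel. x \<in> D"
    using assms by (simp add: AE_density normal_density_pos)
  have "\<exists>y\<in>D. x < y \<and> y < x + 1 / real (Suc n)" for n
  proof (rule ccontr)
    assume no: "\<not> (\<exists>y\<in>D. x < y \<and> y < x + 1 / real (Suc n))"
    have "AE y in lborel. y \<notin> {x <..< x + 1 / real (Suc n)}"
      using AE by eventually_elim (use no in auto)
    then have "emeasure lborel {x <..< x + 1 / real (Suc n)} = 0"
      by (subst (asm) AE_iff_measurable[OF _ refl]) (auto simp: greaterThanLessThan_def greaterThan_def lessThan_def Int_def)
    then show False by simp
  qed
  then obtain xs where xs: "\<And>n. xs n \<in> D" "\<And>n. x < xs n" "\<And>n. xs n < x + 1 / real (Suc n)" by metis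
  have "xs \<longlonglongrightarrow> x"
  proof (rule tendsto_sandwich[where f = "\<lambda>_. x" and h = "\<lambda>n. x + 1 / real (Suc n)"])
    show "(\<lambda>n. x + 1 / real (Suc n)) \<longlonglongrightarrow> x" by real_asymp
  qed (auto intro!: always_eventually less_imp_le xs simp del: of_nat_Suc)
  with xs(1) show ?thesis by blast
qed

text \<open>Provides the hypothesis \<open>support\<close> of
  \<open>cond_distribution_unique\<close> for \<open>R = range h\<close>: the approximation is made
  at a preimage of z and carried over by continuity of \<open>h\<close>.\<close>

lemma image_support:
  assumes "prob_space M" and [measurable]: "X \<in> borel_measurable M" and law: "distr M borel X = normal_law 0 \<sigma>" and "0 < \<sigma>"
    and h: "continuous_on UNIV (h :: real \<Rightarrow> real)"
    and [measurable]: "D \<in> sets borel" and D: "AE \<omega> in M. h (X \<omega>) \<in> D" and z: "z \<in> range h"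
  shows "\<exists>zs. (\<forall>n. zs n \<in> range h \<inter> D) \<and> zs \<longlonglongrightarrow> z"
proof -
  have [measurable]: "h \<in> borel_measurable borel"
    by (rule borel_measurable_continuous_onI[OF h])
  have "AE x in distr M borel X. h x \<in> D"
    using D by (subst AE_distr_iff) auto
  then have "AE x in normal_law 0 \<sigma>. x \<in> h -` D"
    unfolding law by simp
  obtain x where x: "z = h x" using z by auto
  obtain xs where xs: "\<And>n. xs n \<in> h -` D" "xs \<longlonglongrightarrow> x"
    using normal_law_support[OF \<open>0 < \<sigma>\<close> \<open>AE x in normal_law 0 \<sigma>. x \<in> h -` D\<close>] by blast
  have "(\<lambda>n. h (xs n)) \<longlonglongrightarrow> h x"
    using h xs(2) by (simp add: continuous_on_eq_continuous_at isCont_tendsto_compose)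
  with xs(1) x show ?thesis by (intro exI[of _ "\<lambda>n. h (xs n)"]) auto
qed

text \<open>The kernel has to be measurable on the whole line and weakly continuous on
  \<open>range h\<close>, so its inverse must be a total Borel function that is continuous there.
  The range is open, and the default 0 outside it preserves measurability.\<close>

lemma continuous_left_inverse:
  fixes h :: "real \<Rightarrow> real"
  assumes h: "strict_mono h" "continuous_on UNIV h"
  obtains g where "g \<in> borel_measurable borel" "continuous_on (range h) g" "\<And>x. g (h x) = x"
proof -
  have inj: "inj h" using h(1) by (rule strict_mono_imp_inj_on)
  then obtain g where g: "homeomorphism UNIV (range h) h g"
    using injective_into_1d_eq_homeomorphism[OF h(2)] by auto
  have "open (range h)"
    using injective_into_1d_imp_open_map_UNIV[OF open_UNIV h(2) inj] by simp
  then have "(\<lambda>y. if y \<in> range h then g y else 0) \<in> borel_measurable borel"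
    using g by (intro borel_measurable_continuous_on_if) (auto simp: homeomorphism_def)
  moreover have "continuous_on (range h) (\<lambda>y. if y \<in> range h then g y else 0)"
    using g by (subst continuous_on_cong[OF refl, of _ _ g]) (auto simp: homeomorphism_def)
  moreover have "(if h x \<in> range h then g (h x) else 0) = x" for x
    using g by (auto simp: homeomorphism_def)
  ultimately show ?thesis using that by blast
qed

text \<open>Independence makes the joint law of \<open>X\<close> and \<open>Z\<close> a product;
  integrating out \<open>Z\<close> first leaves the integral of the kernel over the law of
  \<open>X\<close>.\<close>

theorem normal_transition_kernel:
  fixes h :: "real \<Rightarrow> real"
  assumes "prob_space M" and h: "strict_mono h" "continuous_on UNIV h"
    and ind: "prob_space.indep_var M borel X borel Z" and law: "distr M borel Z = normal_law 0 s" and s: "0 < s"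
  shows "\<exists>K. cond_distribution M (\<lambda>\<omega>. h (X \<omega>)) (\<lambda>\<omega>. h (r * X \<omega> + Z \<omega>)) (range h) K \<and>
    (\<forall>x. K (h x) = distr (normal_law (r * x) s) borel h)"
proof -
  interpret prob_space M by fact
  interpret N: prob_space "normal_law 0 s" by (rule prob_space_normal_density[OF s])
  have [measurable]: "h \<in> borel_measurable borel"
    by (rule borel_measurable_continuous_onI[OF h(2)])
  have rv[measurable]: "X \<in> borel_measurable M" "Z \<in> borel_measurable M"
    using indep_var_rv1[OF ind] indep_var_rv2[OF ind] .
  obtain g where g[measurable]: "g \<in> borel_measurable borel" and gc: "continuous_on (range h) g" and gh: "\<And>x. g (h x) = x"
    using continuous_left_inverse[OF h] by blast
  \<comment> \<open>Pushing one fixed law forward by a map that depends on y reduces weak continuity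
    to pointwise convergence of the maps, via \<open>char_tendsto_AE\<close>.\<close>
  define K where "K y = distr (normal_law 0 s) borel (\<lambda>z. h (r * g y + z))" for y
  have KB: "measure (K y) B = measure (normal_law 0 s) {z. h (r * g y + z) \<in> B}" if "B \<in> sets borel" for y B
    unfolding K_def using that by (subst measure_distr) (auto intro!: arg_cong[where f="measure _"])
  have law_shift: "distr (normal_law 0 s) borel (\<lambda>z. m + z) = normal_law m s" for m
  proof -
    have "distributed (normal_law 0 s) lborel (\<lambda>x. x) (normal_density 0 s)"
      by (auto simp: distributed_def intro!: distr_id2)
    from N.normal_density_affine[OF this s, of 1 m] show ?thesis
      by (auto simp: distributed_def cong: distr_cong)
  qed
  have K_h: "K (h x) = distr (normal_law (r * x) s) borel h" for x
    unfolding law_shift[of "r * x", symmetric] K_def gh by (subst distr_distr) (auto simp: comp_def)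
  have "cond_distribution M (\<lambda>\<omega>. h (X \<omega>)) (\<lambda>\<omega>. h (r * X \<omega> + Z \<omega>)) (range h) K"
    unfolding cond_distribution_def
  proof (intro conjI ballI allI impI)
    have "normal_law 0 s \<in> space (prob_algebra borel)"
      by (simp add: space_prob_algebra N.prob_space_axioms)
    then show K: "K \<in> borel \<rightarrow>\<^sub>M prob_algebra borel"
      unfolding K_def[abs_def] by measurable
    fix A B :: "real set" assume [measurable]: "A \<in> sets borel" "B \<in> sets borel"
    let ?J = "{p. h (fst p) \<in> A \<and> h (r * fst p + snd p) \<in> B}"
    have KBm[measurable]: "(\<lambda>y. measure (K y) B) \<in> borel_measurable borel"
      by (rule measurable_compose[OF K measurable_measure_prob_algebra]) simp
    have "{p \<in> space (borel \<Otimes>\<^sub>M borel). h (fst p) \<in> A \<and> h (r * fst p + snd p) \<in> B} \<in> sets (borel \<Otimes>\<^sub>M borel)"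
      by measurable
    then have J: "?J \<in> sets (borel \<Otimes>\<^sub>M borel)" by (simp add: space_pair_measure)
    have "ennreal (prob {\<omega> \<in> space M. h (X \<omega>) \<in> A \<and> h (r * X \<omega> + Z \<omega>) \<in> B}) =
      emeasure (distr M (borel \<Otimes>\<^sub>M borel) (\<lambda>\<omega>. (X \<omega>, Z \<omega>))) ?J"
      using J by (subst emeasure_distr) (auto simp: emeasure_eq_measure intro!: arg_cong[where f=prob])
    also have "\<dots> = emeasure (distr M borel X \<Otimes>\<^sub>M normal_law 0 s) ?J"
      using ind unfolding indep_var_distribution_eq law by simp
    also have "\<dots> = (\<integral>\<^sup>+x. emeasure (normal_law 0 s) (Pair x -` ?J) \<partial>distr M borel X)"
      using J by (intro N.emeasure_pair_measure_alt) (simp cong: sets_pair_measure_cong)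
    also have "\<dots> = (\<integral>\<^sup>+x. ennreal (indicator A (h x) * measure (K (h x)) B) \<partial>distr M borel X)"
    proof (rule nn_integral_cong)
      fix x
      have "Pair x -` ?J = (if h x \<in> A then {z. h (r * x + z) \<in> B} else {})" by auto
      then show "emeasure (normal_law 0 s) (Pair x -` ?J) = ennreal (indicator A (h x) * measure (K (h x)) B)"
        by (simp add: KB gh N.emeasure_eq_measure)
    qed
    also have "\<dots> = (\<integral>\<^sup>+\<omega>. ennreal (indicator A (h (X \<omega>)) * measure (K (h (X \<omega>))) B) \<partial>M)"
      by (subst nn_integral_distr) auto
    also have "\<dots> = ennreal (\<integral>\<omega>. indicator A (h (X \<omega>)) * measure (K (h (X \<omega>))) B \<partial>M)"
    proof (rule nn_integral_eq_integral)
      have "measure (K y) B \<le> 1" for y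
        using real_distribution_kernel[OF K, of y] by (simp add: real_distribution_def prob_space.prob_le_1)
      then show "integrable M (\<lambda>\<omega>. indicator A (h (X \<omega>)) * measure (K (h (X \<omega>))) B)"
        by (intro integrable_const_bound[where B = 1]) (auto simp: indicator_def)
    qed auto
    finally show "prob {\<omega> \<in> space M. h (X \<omega>) \<in> A \<and> h (r * X \<omega> + Z \<omega>) \<in> B} =
      (\<integral>\<omega>. indicator A (h (X \<omega>)) * measure (K (h (X \<omega>))) B \<partial>M)"
      by (subst (asm) ennreal_inj) (auto intro!: integral_nonneg_AE)
  next
    fix z zs assume "z \<in> range h \<and> (\<forall>n. zs n \<in> range h) \<and> zs \<longlonglongrightarrow> z"
    then have z: "z \<in> range h" "\<And>n. zs n \<in> range h" "zs \<longlonglongrightarrow> z" by auto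
    have gz: "(\<lambda>n. g (zs n)) \<longlonglongrightarrow> g z"
      by (rule continuous_on_tendsto_compose[OF gc z(3,1)]) (simp add: z)
    have rd: "real_distribution (K y)" for y
      unfolding K_def by (rule N.real_distribution_distr) simp
    show "weak_conv_m (\<lambda>n. K (zs n)) (K z)"
    proof (rule levy_continuity[OF rd rd])
      fix t
      show "(\<lambda>n. char (K (zs n)) t) \<longlonglongrightarrow> char (K z) t"
        unfolding K_def
      proof (rule N.char_tendsto_AE)
        have "(\<lambda>n. h (r * g (zs n) + y)) \<longlonglongrightarrow> h (r * g z + y)" for y
          by (rule continuous_on_tendsto_compose[OF h(2)]) (auto intro!: tendsto_intros gz)
        then show "AE y in normal_law 0 s. (\<lambda>n. h (r * g (zs n) + y)) \<longlonglongrightarrow> h (r * g z + y)" by simp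
      qed measurable
    qed
  qed
  with K_h show ?thesis by blast
qed

section \<open>Tails of the transformed process, its transitions and its increments\<close>

lemma measure_greater_eq:
  assumes "real_distribution P" "h \<in> borel_measurable borel"
  shows "1 - measure P {x. h x \<le> y} = measure P {x. h x > (y :: real)}"
proof -
  interpret real_distribution P by fact
  have "{x. h x \<le> y} \<in> sets borel" using assms(2) by measurable
  moreover have "UNIV - {x. h x \<le> y} = {x. h x > y}" by auto
  ultimately show ?thesis using prob_compl[of "{x. h x \<le> y}"] by simp
qed

theorem theorem1:
  fixes M :: "'a measure" and X Y :: "real \<Rightarrow> 'a \<Rightarrow> real" and h F :: "real \<Rightarrow> real"
    and \<alpha> \<tau> \<sigma>2 bp bm :: real and \<sigma>2c :: "real \<Rightarrow> real"
  assumes "\<alpha> > 0" and "\<tau> > 0"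
    and "stationary_OU M \<alpha> \<tau> X"
    and "strict_mono h" and "continuous_on UNIV h"
    and Y: "Y = (\<lambda>t \<omega>. h (X t \<omega>))"
    and F: "F = (\<lambda>y. measure M {\<omega> \<in> space M. Y 0 \<omega> \<le> y})"
    and \<sigma>2: "\<sigma>2 = \<tau>\<^sup>2 / (2 * \<alpha>)"
    and \<sigma>2c: "\<sigma>2c = (\<lambda>u. \<tau>\<^sup>2 / (2 * \<alpha>) * (1 - exp (- 2 * \<alpha> * u)))"
  shows
    \<comment> \<open>the distribution function of \<open>Y t\<close> does not depend on \<open>t\<close>\<close>
    "(\<forall>t\<ge>0. \<forall>y. measure M {\<omega> \<in> space M. Y t \<omega> \<le> y} = F y)
     \<and>
     (cond_A_plus h bp \<longrightarrow>
        1 / (2 * bp * \<sigma>2) = \<alpha> / (bp * \<tau>\<^sup>2) \<and>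
        (\<exists>L. slowly_varying L \<and> (\<forall>y>0. 1 - F y = y powr (- (1 / (2 * bp * \<sigma>2))) * L y)))
     \<and>
     (cond_A_minus h bm \<longrightarrow>
        1 / (2 * bm * \<sigma>2) = \<alpha> / (bm * \<tau>\<^sup>2) \<and>
        (\<exists>L. slowly_varying L \<and> (\<forall>y>0. F (- y) = y powr (- (1 / (2 * bm * \<sigma>2))) * L y)))
     \<and>
     (\<forall>s t. 0 \<le> s \<and> s < t \<longrightarrow>
        (\<exists>K. cond_distribution M (Y s) (Y t) (range h) K) \<and>
        (\<forall>K. cond_distribution M (Y s) (Y t) (range h) K \<longrightarrow>
           (cond_A_plus h bp \<longrightarrow>
              (\<forall>ys \<in> range h.
                 regularly_varying (- (1 / (2 * bp * \<sigma>2c (t - s)))) (\<lambda>y. 1 - cdf (K ys) y)) \<and>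
              - (1 / (2 * bp * \<sigma>2c (t - s)))
                = - (\<alpha> / (bp * \<tau>\<^sup>2 * (1 - exp (- 2 * \<alpha> * (t - s))))) \<and>
              - (\<alpha> / (bp * \<tau>\<^sup>2 * (1 - exp (- 2 * \<alpha> * (t - s))))) < - (\<alpha> / (bp * \<tau>\<^sup>2))) \<and>
           (cond_A_minus h bm \<longrightarrow>
              (\<forall>ys \<in> range h.
                 regularly_varying (- (1 / (2 * bm * \<sigma>2c (t - s)))) (\<lambda>y. cdf (K ys) (- y))))))
     \<and>
     (cond_A_plus h bp \<and> (\<lambda>x. h (- x)) \<in> o[at_top](h) \<longrightarrow>
        (\<forall>s t. 0 \<le> s \<and> s < t \<longrightarrow>
           (\<lambda>y. measure M {\<omega> \<in> space M. Y t \<omega> - Y s \<omega> > y}) \<sim>[at_top] (\<lambda>y. 1 - F y)))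
     \<and>
     (cond_A_minus h bm \<and> h \<in> o[at_top](\<lambda>x. h (- x)) \<longrightarrow>
        (\<forall>s t. 0 \<le> s \<and> s < t \<longrightarrow>
           (\<lambda>y. measure M {\<omega> \<in> space M. Y t \<omega> - Y s \<omega> > y}) \<sim>[at_top] (\<lambda>y. F (- y))))"
proof -
  note \<alpha> = assms(1) and \<tau> = assms(2) and OU = assms(3) and h = assms(4,5)
  from OU interpret prob_space M by (simp add: stationary_OU_def)
  define \<sigma> where "\<sigma> = sqrt \<sigma>2"
  have \<sigma>: "0 < \<sigma>" "\<sigma>\<^sup>2 = \<sigma>2" using \<alpha> \<tau> by (simp_all add: \<sigma>_def \<sigma>2)
  define N where "N = normal_law 0 \<sigma>"
  have N: "real_distribution N" unfolding N_def by (rule real_distribution_normal_law[OF \<sigma>(1)])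
  have hm[measurable]: "h \<in> borel_measurable borel"
    by (rule borel_measurable_continuous_onI[OF h(2)])
  have X[measurable]: "X t \<in> borel_measurable M" if "0 \<le> t" for t
    using OU that by (simp add: stationary_OU_def stationary_process_def)
  have law: "distr M borel (X t) = N" if "0 \<le> t" for t
    using stationary_OU_law[OF \<alpha> \<tau> OU that] by (simp only: N_def \<sigma>_def \<sigma>2)
  have event: "prob {\<omega> \<in> space M. X t \<omega> \<in> A} = measure N A" if "0 \<le> t" "A \<in> sets borel" for t A
    using X[OF that(1)] that(2) unfolding law[OF that(1), symmetric]
    by (subst measure_distr) (auto intro!: arg_cong[where f=prob])
  have le_event: "prob {\<omega> \<in> space M. h (X t \<omega>) \<le> y} = measure N {x. h x \<le> y}" if "0 \<le> t" for t y
    using event[OF that, of "{x. h x \<le> y}"] by simp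
  have gt_event: "prob {\<omega> \<in> space M. h (X t \<omega>) > y} = measure N {x. h x > y}" if "0 \<le> t" for t y
    using event[OF that, of "{x. h x > y}"] by simp
  have F_eq: "F y = measure N {x. h x \<le> y}" for y
    using le_event[of 0 y] by (simp add: F Y)
  have F_right: "1 - F y = measure N {x. h x > y}" for y
    unfolding F_eq by (rule measure_greater_eq[OF N hm])
  \<comment> \<open>In this form the left tail of F is a right tail of the reflected function, as
    the last increment statement needs it.\<close>
  have F_left: "F (- y) = measure N {x. - h (- x) > y}" for y
    using normal_law_left_tail[OF h \<sigma>(1), of 0 y] by (simp add: F_eq N_def)

  have stationary: "\<forall>t\<ge>0. \<forall>y. measure M {\<omega> \<in> space M. Y t \<omega> \<le> y} = F y"
    using le_event by (simp add: F_eq Y)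
  have index: "1 / (2 * b * \<sigma>2) = \<alpha> / (b * \<tau>\<^sup>2)" for b
    using \<alpha> \<tau> by (simp add: \<sigma>2)
  have right: "\<exists>L. slowly_varying L \<and> (\<forall>y>0. 1 - F y = y powr (- (1 / (2 * bp * \<sigma>2))) * L y)"
    if "cond_A_plus h bp"
    using normal_law_tail_regularly_varying[OF h that \<sigma>(1), of 0]
    unfolding regularly_varying_def F_right N_def \<sigma>(2) .
  have left: "\<exists>L. slowly_varying L \<and> (\<forall>y>0. F (- y) = y powr (- (1 / (2 * bm * \<sigma>2))) * L y)"
    if "cond_A_minus h bm"
    using normal_law_left_tail_regularly_varying[OF h that \<sigma>(1), of 0]
    unfolding regularly_varying_def F_eq N_def \<sigma>(2) .

  have transition: "(\<exists>K. cond_distribution M (Y s) (Y t) (range h) K) \<and>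
        (\<forall>K. cond_distribution M (Y s) (Y t) (range h) K \<longrightarrow>
           (cond_A_plus h bp \<longrightarrow>
              (\<forall>ys \<in> range h.
                 regularly_varying (- (1 / (2 * bp * \<sigma>2c (t - s)))) (\<lambda>y. 1 - cdf (K ys) y)) \<and>
              - (1 / (2 * bp * \<sigma>2c (t - s)))
                = - (\<alpha> / (bp * \<tau>\<^sup>2 * (1 - exp (- 2 * \<alpha> * (t - s))))) \<and>
              - (\<alpha> / (bp * \<tau>\<^sup>2 * (1 - exp (- 2 * \<alpha> * (t - s))))) < - (\<alpha> / (bp * \<tau>\<^sup>2))) \<and>
           (cond_A_minus h bm \<longrightarrow>
              (\<forall>ys \<in> range h.
                 regularly_varying (- (1 / (2 * bm * \<sigma>2c (t - s)))) (\<lambda>y. cdf (K ys) (- y)))))"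
    if st: "0 \<le> s" "s < t" for s t
  proof -
    define \<rho> where "\<rho> = exp (- (\<alpha> * (t - s)))"
    define Z where "Z \<omega> = X t \<omega> - \<rho> * X s \<omega>" for \<omega>
    define e where "e = exp (- 2 * \<alpha> * (t - s))"
    have e: "0 < e" "e < 1" using \<alpha> st by (simp_all add: e_def)
    define v where "v = sqrt (\<sigma>2c (t - s))"
    have v: "0 < v" "v\<^sup>2 = \<sigma>2c (t - s)"
      using \<alpha> \<tau> e by (simp_all add: v_def \<sigma>2c e_def)
    have ind: "indep_var borel (X s) borel Z"
      using stationary_OU_transition(1)[OF \<alpha> \<tau> OU st] unfolding Z_def[abs_def] \<rho>_def .
    have lawZ: "distr M borel Z = normal_law 0 v"
      using stationary_OU_transition(2)[OF \<alpha> \<tau> OU st] unfolding Z_def[abs_def] \<rho>_def[symmetric] v_def \<sigma>2c .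
    have Yt: "Y t = (\<lambda>\<omega>. h (\<rho> * X s \<omega> + Z \<omega>))" and Ys: "Y s = (\<lambda>\<omega>. h (X s \<omega>))"
      by (simp_all add: Y Z_def)
    obtain K0 where K0: "cond_distribution M (Y s) (Y t) (range h) K0"
      and K0_h: "\<And>x. K0 (h x) = distr (normal_law (\<rho> * x) v) borel h"
      using normal_transition_kernel[OF prob_space_axioms h ind lawZ v(1), of \<rho>] unfolding Yt Ys by blast
    \<comment> \<open>The kernel \<open>K\<close> is arbitrary here; uniqueness lets it be exchanged
      for \<open>K0\<close> at each point of \<open>range h\<close>, where the law is
      explicit.\<close>
    have cdf: "cdf (K (h x)) y = measure (normal_law (\<rho> * x) v) {x. h x \<le> y}"
      if K: "cond_distribution M (Y s) (Y t) (range h) K" for K x y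
    proof -
      have "K (h x) = K0 (h x)"
      proof (rule cond_distribution_unique[OF prob_space_axioms _ K K0])
        show "Y s \<in> borel_measurable M" unfolding Ys using X[OF st(1)] by measurable
        fix D z assume "D \<in> sets borel" "AE \<omega> in M. Y s \<omega> \<in> D" "z \<in> range h"
        then show "\<exists>zs. (\<forall>n. zs n \<in> range h \<inter> D) \<and> zs \<longlonglongrightarrow> z"
          using image_support[OF prob_space_axioms X[OF st(1)] law[OF st(1), unfolded N_def] \<sigma>(1) h(2)]
          unfolding Ys by blast
      qed simp
      then show ?thesis
        by (simp add: K0_h cdf_def measure_distr vimage_def)
    qed
    have plus: "regularly_varying (- (1 / (2 * bp * \<sigma>2c (t - s)))) (\<lambda>y. 1 - cdf (K (h x)) y)"
      if "cond_A_plus h bp" "cond_distribution M (Y s) (Y t) (range h) K" for K x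
      unfolding cdf[OF that(2)] measure_greater_eq[OF real_distribution_normal_law[OF v(1)] hm] v(2)[symmetric]
      by (rule normal_law_tail_regularly_varying[OF h that(1) v(1)])
    have minus: "regularly_varying (- (1 / (2 * bm * \<sigma>2c (t - s)))) (\<lambda>y. cdf (K (h x)) (- y))"
      if "cond_A_minus h bm" "cond_distribution M (Y s) (Y t) (range h) K" for K x
      unfolding cdf[OF that(2)] v(2)[symmetric]
      by (rule normal_law_left_tail_regularly_varying[OF h that(1) v(1)])
    have idx: "1 / (2 * bp * \<sigma>2c (t - s)) = \<alpha> / (bp * \<tau>\<^sup>2 * (1 - e))"
      using \<alpha> \<tau> e unfolding \<sigma>2c e_def[symmetric] by simp
    have less: "\<alpha> / (bp * \<tau>\<^sup>2) < \<alpha> / (bp * \<tau>\<^sup>2 * (1 - e))" if "cond_A_plus h bp"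
    proof (rule divide_strict_left_mono)
      have "0 < bp" using that by (simp add: cond_A_plus_def)
      then have c: "0 < bp * \<tau>\<^sup>2" using \<tau> by simp
      then show "bp * \<tau>\<^sup>2 * (1 - e) < bp * \<tau>\<^sup>2"
        using mult_strict_left_mono[of "1 - e" 1 "bp * \<tau>\<^sup>2"] e by linarith
      show "0 < bp * \<tau>\<^sup>2 * (bp * \<tau>\<^sup>2 * (1 - e))"
        by (rule mult_pos_pos[OF c mult_pos_pos[OF c]]) (use e in linarith)
    qed (rule \<alpha>)
    show ?thesis
      unfolding e_def[symmetric]
    proof (intro conjI allI impI ballI exI[of _ K0] K0)
      show "regularly_varying (- (1 / (2 * bp * \<sigma>2c (t - s)))) (\<lambda>y. 1 - cdf (K ys) y)"
        if "cond_A_plus h bp" "cond_distribution M (Y s) (Y t) (range h) K" "ys \<in> range h" for K ys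
        using plus[OF that(1,2)] that(3) by blast
      show "regularly_varying (- (1 / (2 * bm * \<sigma>2c (t - s)))) (\<lambda>y. cdf (K ys) (- y))"
        if "cond_A_minus h bm" "cond_distribution M (Y s) (Y t) (range h) K" "ys \<in> range h" for K ys
        using minus[OF that(1,2)] that(3) by blast
    qed (simp_all only: idx neg_less_iff_less less)
  qed

  have increment_right: "(\<lambda>y. measure M {\<omega> \<in> space M. Y t \<omega> - Y s \<omega> > y}) \<sim>[at_top] (\<lambda>y. 1 - F y)"
    if A: "cond_A_plus h bp" and small: "(\<lambda>x. h (- x)) \<in> o[at_top](h)" and st: "0 \<le> s" "s < t" for s t
  proof -
    have t: "0 \<le> t" using st by simp
    obtain w where w: "0 < w" "w < 2 * \<sigma>" "distr M borel (\<lambda>\<omega>. X t \<omega> + X s \<omega>) = normal_law 0 w"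
      using stationary_OU_sum_law[OF \<alpha> \<tau> OU st] unfolding \<sigma>_def \<sigma>2 by blast
    show ?thesis
      using increment_tail_asymp_equiv[OF h A small X[OF t] X[OF st(1)]
          law[OF t, unfolded N_def] law[OF st(1), unfolded N_def] w(3) \<sigma>(1) w(1,2)]
      unfolding F_right Y gt_event[OF t] .
  qed
  have increment_left: "(\<lambda>y. measure M {\<omega> \<in> space M. Y t \<omega> - Y s \<omega> > y}) \<sim>[at_top] (\<lambda>y. F (- y))"
    if A: "cond_A_minus h bm" and small: "h \<in> o[at_top](\<lambda>x. h (- x))" and st: "0 \<le> s" "s < t" for s t
  proof -
    have t: "0 \<le> t" using st by simp
    obtain w where w: "0 < w" "w < 2 * \<sigma>" "distr M borel (\<lambda>\<omega>. X t \<omega> + X s \<omega>) = normal_law 0 w"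
      using stationary_OU_sum_law[OF \<alpha> \<tau> OU st] unfolding \<sigma>_def \<sigma>2 by blast
    have neg: "distr M borel (\<lambda>\<omega>. - f \<omega>) = normal_law 0 a"
      if "f \<in> borel_measurable M" "distr M borel f = normal_law 0 a" "0 < a" for f a
    proof -
      have "distr M borel (\<lambda>\<omega>. - f \<omega>) = distr (distr M borel f) borel uminus"
        using that(1) by (subst distr_distr) (auto simp: comp_def)
      also have "\<dots> = distr (normal_law 0 a) lborel uminus"
        unfolding that(2) by (rule distr_cong) auto
      finally show ?thesis by (simp add: distr_uminus_normal_law[OF that(3)])
    qed
    have lawneg: "distr M borel (\<lambda>\<omega>. - X t \<omega>) = normal_law 0 \<sigma>" if "0 \<le> t" for t
      by (rule neg[OF X[OF that] law[OF that, unfolded N_def] \<sigma>(1)])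
    have "(\<lambda>\<omega>. X t \<omega> + X s \<omega>) \<in> borel_measurable M"
      using X[OF t] X[OF st(1)] by measurable
    from neg[OF this w(3,1)] have sum: "distr M borel (\<lambda>\<omega>. - X s \<omega> + - X t \<omega>) = normal_law 0 w"
      by (simp add: algebra_simps)
    have small': "(\<lambda>x. - h (- (- x))) \<in> o[at_top](\<lambda>x. - h (- x))"
      using small by simp
    have gt: "prob {\<omega> \<in> space M. - h (- (- X s \<omega>)) > y} = F (- y)" for y
    proof -
      have "prob {\<omega> \<in> space M. - h (- (- X s \<omega>)) > y} = measure (distr M borel (\<lambda>\<omega>. - X s \<omega>)) {x. - h (- x) > y}"
        using X[OF st(1)] by (subst measure_distr) (auto intro!: arg_cong[where f=prob])
      then show ?thesis by (simp only: lawneg[OF st(1)] F_left N_def)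
    qed
    \<comment> \<open>With \<open>g x = - h (- x)\<close> the increment Y t - Y s is
      \<open>g (- X s) - g (- X t)\<close>: reflection exchanges the two times, and
      \<open>- X s\<close> becomes the variable that governs the tail.\<close>
    have "(\<lambda>y. prob {\<omega> \<in> space M. - h (- (- X s \<omega>)) - - h (- (- X t \<omega>)) > y}) \<sim>[at_top]
        (\<lambda>y. prob {\<omega> \<in> space M. - h (- (- X s \<omega>)) > y})"
      using X[OF t] X[OF st(1)]
      by (intro increment_tail_asymp_equiv[OF reflect_strict_mono[OF h(1)] reflect_continuous[OF h(2)]
          cond_A_minus_reflect[OF A] small' _ _ lawneg[OF st(1)] lawneg[OF t] sum \<sigma>(1) w(1,2)]) auto
    then show ?thesis
      unfolding gt by (simp add: Y)
  qed
  show ?thesis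
    by (intro conjI allI impI stationary[rule_format] index right left transition increment_right increment_left;
        (elim conjE)?; assumption)
qed

end
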